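(* Let $(c_n)_{n\in\mathbb{N}_0}$ be an increasing sequence of positive numbers which is not quasi-analytic and let $m=(m^{(n)})_{n\in\mathbb{N}_0}\in\mathcal{F}(\mathscr{D}'(\mathbb{R}^d))$. For any $n\in\mathbb{N}_0$, let $k^{(n)}=(k_1^{(n)},k_2^{(n)})\in I$ be such that $m^{(n)}\in H_{-k^{(n)}}^{\otimes n}$. Then the set $$E:=\Big\{f\in\mathscr{D}(\mathbb{R}^d)\ \Big|\ \forall n\in\mathbb{N}_0:\ \|f\|_{H_{k^{(n)}}}\le \big(c_{k_1^{(n)}}\big)^d\ \sup_{\mathbf{z}\in\mathbb{R}^d,\ \|\mathbf{z}\|\le n}\ \sup_{\mathbf{x}\in[-1,1]^d}\sqrt{k_2^{(n)}(\mathbf{z}+\mathbf{x})}\Big\}$$ is total in $\mathscr{D}(\mathbb{R}^d)$, i.e. its linear span is dense in $\mathscr{D}(\mathbb{R}^d)$.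
   Context: $\mathcal{C}_c^\infty(\mathbb{R}^d)$ is the space of real-valued infinitely differentiable functions on $\mathbb{R}^d$ with compact support. $I$ is the set of all pairs $k=(k_1,k_2)$ with $k_1\in\mathbb{N}_0$, $k_2\in\mathcal{C}^\infty(\mathbb{R}^d)$ and $k_2(\mathbf{r})\ge1$ for all $\mathbf{r}\in\mathbb{R}^d$. For $k\in I$, $H_k=W_2^{k_1}(\mathbb{R}^d,k_2(\mathbf{r})d\mathbf{r})$ is the completion of $\mathcal{C}_c^\infty(\mathbb{R}^d)$ with respect to the norm $$\|\varphi\|_{H_k}=\Big(\sum_{|\beta|\le k_1}\int_{\mathbb{R}^d}|D^\beta\varphi(\mathbf{r})|^2k_2(\mathbf{r})\,d\mathbf{r}\Big)^{1/2}.$$ $\mathscr{D}(\mathbb{R}^d)$ denotes $\mathcal{C}_c^\infty(\mathbb{R}^d)$ with the projective limit topology of the family $(H_k)_{k\in I}$ (as a set the projective limit is $\mathcal{C}_c^\infty(\mathbb{R}^d)$), and $\mathscr{D}'(\mathbb{R}^d)$ is its topological dual; $\mathscr{D}'(\mathbb{R}^{dn})$ is defined in the same way on $\mathbb{R}^{dn}$. $H_{-k}$ denotes the dual of $H_k$ and $H_{-k}^{\otimes n}$ its Hilbert space tensor power, identified with the dual of $H_k^{\otimes n}$ (equal to $\mathbb{R}$ for $n=0$); one has $\mathscr{D}'(\mathbb{R}^{dn})=\bigcup_{k\in I}H_{-k}^{\otimes n}$. $\mathcal{F}(\mathscr{D}'(\mathbb{R}^d))$ is the set of all sequences $(m^{(n)})_{n\in\mathbb{N}_0}$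 such that each $m^{(n)}\in\mathscr{D}'(\mathbb{R}^{dn})$ is a symmetric functional of its $n$ variables in $\mathbb{R}^d$ ($m^{(0)}\in\mathbb{R}$). For a sequence $(M_n)_{n\in\mathbb{N}_0}$ of positive reals, $C\{M_n\}$ is the set of $f\in\mathcal{C}^\infty(\mathbb{R})$ for which there are constants $\beta_f,B_f>0$ with $\sup_{x\in\mathbb{R}}|D^nf(x)|\le\beta_fB_f^nM_n$ for all $n\in\mathbb{N}_0$; the class is quasi-analytic if every $f\in C\{M_n\}$ with $D^nf(0)=0$ for all $n\in\mathbb{N}_0$ vanishes identically. The sequence $(M_n)$ is called not quasi-analytic if the class $C\{M_n\}$ is not quasi-analytic. *)

theory Defs
  imports "HOL-Analysis.Analysis"
begin

section \<open>Smooth functions and test functions on \<open>\<real>\<^sup>d\<close>\<close>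

definition partial :: "'d::finite \<Rightarrow> (real^'d \<Rightarrow> real) \<Rightarrow> real^'d \<Rightarrow> real" where
  "partial i f x = deriv (\<lambda>t. f (x + t *\<^sub>R axis i 1)) 0"

text \<open>Since \<^term>\<open>deriv\<close> is total, existence of the derivatives is expressed by requiring every
  iterated partial derivative to be (Frechet) differentiable everywhere.\<close>

definition smooth :: "(real^'d::finite \<Rightarrow> real) \<Rightarrow> bool" where
  "smooth f \<longleftrightarrow> (\<forall>js. (foldr partial js f) differentiable_on UNIV)"

definition test_functions :: "(real^'d::finite \<Rightarrow> real) set" where
  "test_functions = {f. smooth f \<and> compact (closure {x. f x \<noteq> 0})}"

text \<open>A finite index type carries no order, so an enumeration of the coordinates is fixed in which
  the factors of \<open>D\<^sup>\<beta>\<close> are applied. By Schwarz's theorem it does not matter which one for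
  smooth functions.\<close>

definition coords :: "'d::finite list" where
  "coords = (SOME js. distinct js \<and> set js = UNIV)"

definition multi_deriv ::
  "('j \<Rightarrow> 'f \<Rightarrow> 'f) \<Rightarrow> 'j list \<Rightarrow> ('j \<Rightarrow> nat) \<Rightarrow> 'f \<Rightarrow> 'f" where
  "multi_deriv D js \<beta> f = foldr (\<lambda>j. D j ^^ \<beta> j) js f"

abbreviation D_multi :: "('d::finite \<Rightarrow> nat) \<Rightarrow> (real^'d \<Rightarrow> real) \<Rightarrow> real^'d \<Rightarrow> real" where
  "D_multi \<equiv> multi_deriv partial coords"

section \<open>Weighted Sobolev norms and the space \<open>\<D>(\<real>\<^sup>d)\<close>\<close>

definition weight_index :: "(nat \<times> (real^'d::finite \<Rightarrow> real)) set" where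
  "weight_index = {(k1, k2). smooth k2 \<and> (\<forall>r. 1 \<le> k2 r)}"

definition H_norm :: "nat \<times> (real^'d::finite \<Rightarrow> real) \<Rightarrow> (real^'d \<Rightarrow> real) \<Rightarrow> real" where
  "H_norm k f = sqrt (\<Sum>\<beta> | sum \<beta> UNIV \<le> fst k.
     integral\<^sup>L lborel (\<lambda>r. \<bar>D_multi \<beta> f r\<bar>\<^sup>2 * snd k r))"

definition H_inner ::
  "nat \<times> (real^'d::finite \<Rightarrow> real) \<Rightarrow> (real^'d \<Rightarrow> real) \<Rightarrow> (real^'d \<Rightarrow> real) \<Rightarrow> real" where
  "H_inner k f g = (\<Sum>\<beta> | sum \<beta> UNIV \<le> fst k.
     integral\<^sup>L lborel (\<lambda>r. D_multi \<beta> f r * D_multi \<beta> g r * snd k r))"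

text \<open>The projective limit topology on a function space \<open>V\<close> for a family \<open>P\<close> of norms is the
  coarsest topology for which all inclusions of \<open>V\<close> into the completions of \<open>(V, p)\<close>, \<open>p \<in> P\<close>, are
  continuous. As these inclusions are isometric with dense range, it is generated by the balls of
  the norms with centre in \<open>V\<close>.\<close>

definition projective_topology ::
  "('a \<Rightarrow> real) set \<Rightarrow> (('a \<Rightarrow> real) \<Rightarrow> real) set \<Rightarrow> ('a \<Rightarrow> real) topology" where
  "projective_topology V P = topology_generated_by
     {{g \<in> V. p (\<lambda>x. g x - f x) < e} | p f e. p \<in> P \<and> f \<in> V \<and> 0 < e}"

definition D_topology :: "(real^'d::finite \<Rightarrow> real) topology" where
  "D_topology = projective_topology test_functions (H_norm ` weight_index)"

definition linear_span :: "('a \<Rightarrow> real) set \<Rightarrow> ('a \<Rightarrow> real) set" where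
  "linear_span E = {(\<lambda>x. \<Sum>f\<in>F. a f * f x) | F a. finite F \<and> F \<subseteq> E}"

definition topological_dual ::
  "('a \<Rightarrow> real) set \<Rightarrow> ('a \<Rightarrow> real) topology \<Rightarrow> (('a \<Rightarrow> real) \<Rightarrow> real) set" where
  "topological_dual V \<tau> = {T. continuous_map \<tau> euclideanreal T \<and>
     (\<forall>f\<in>V. \<forall>g\<in>V. \<forall>a b. T (\<lambda>x. a * f x + b * g x) = a * T f + b * T g)}"

section \<open>The spaces \<open>\<D>(\<real>\<^sup>d\<^sup>n)\<close> and \<open>\<D>'(\<real>\<^sup>d\<^sup>n)\<close>\<close>

text \<open>As \<open>n\<close> varies within the statement, a point of \<open>\<real>\<^sup>d\<^sup>n\<close> is a family of \<open>n\<close> points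
  of \<open>\<real>\<^sup>d\<close>, indexed by \<open>{..<n}\<close>; the product topology of \<^typ>\<open>nat \<Rightarrow> real^'d\<close> induces the
  usual topology on these families, which form a closed set. Functions on \<open>\<real>\<^sup>d\<^sup>n\<close> are extended
  by \<open>0\<close>; a weight is only ever evaluated on \<open>\<real>\<^sup>d\<^sup>n\<close>. For \<open>n = 0\<close> the space is a single
  point and the dual is \<open>\<real>\<close>.\<close>

definition Rdn :: "nat \<Rightarrow> (nat \<Rightarrow> real^'d::finite) set" where
  "Rdn n = {..<n} \<rightarrow>\<^sub>E UNIV"

definition shift :: "nat \<times> 'd::finite \<Rightarrow> real \<Rightarrow> (nat \<Rightarrow> real^'d) \<Rightarrow> nat \<Rightarrow> real^'d" where
  "shift j t x = x(fst j := x (fst j) + t *\<^sub>R axis (snd j) 1)"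

definition partial_n ::
  "nat \<times> 'd::finite \<Rightarrow> ((nat \<Rightarrow> real^'d) \<Rightarrow> real) \<Rightarrow> (nat \<Rightarrow> real^'d) \<Rightarrow> real" where
  "partial_n j \<phi> x = deriv (\<lambda>t. \<phi> (shift j t x)) 0"

text \<open>\<^typ>\<open>nat \<Rightarrow> real^'d\<close> is not a normed space, so smoothness on \<open>\<real>\<^sup>d\<^sup>n\<close> is
  expressed by existence and continuity of all iterated partial derivatives.\<close>

definition smooth_n :: "nat \<Rightarrow> ((nat \<Rightarrow> real^'d::finite) \<Rightarrow> real) \<Rightarrow> bool" where
  "smooth_n n \<phi> \<longleftrightarrow> (\<forall>js \<in> lists ({..<n} \<times> UNIV).
     continuous_on (Rdn n) (foldr partial_n js \<phi>) \<and>
     (\<forall>j \<in> {..<n} \<times> UNIV. \<forall>x \<in> Rdn n.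
        (\<lambda>t. foldr partial_n js \<phi> (shift j t x)) differentiable (at 0)))"

definition test_functions_n :: "nat \<Rightarrow> ((nat \<Rightarrow> real^'d::finite) \<Rightarrow> real) set" where
  "test_functions_n n = {\<phi>. smooth_n n \<phi> \<and> (\<forall>x. x \<notin> Rdn n \<longrightarrow> \<phi> x = 0) \<and>
     compact (closure {x. \<phi> x \<noteq> 0})}"

definition weight_index_n :: "nat \<Rightarrow> (nat \<times> ((nat \<Rightarrow> real^'d::finite) \<Rightarrow> real)) set" where
  "weight_index_n n = {(k1, k2). smooth_n n k2 \<and> (\<forall>r \<in> Rdn n. 1 \<le> k2 r)}"

definition H_norm_n ::
  "nat \<Rightarrow> nat \<times> ((nat \<Rightarrow> real^'d::finite) \<Rightarrow> real) \<Rightarrow> ((nat \<Rightarrow> real^'d) \<Rightarrow> real) \<Rightarrow> real" where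
  "H_norm_n n k \<phi> =
     sqrt (\<Sum>\<beta> | \<beta> \<in> ({..<n} \<times> UNIV) \<rightarrow>\<^sub>E UNIV \<and> sum \<beta> ({..<n} \<times> UNIV) \<le> fst k.
       integral\<^sup>L (\<Pi>\<^sub>M l\<in>{..<n}. lborel)
         (\<lambda>r. \<bar>multi_deriv partial_n (List.product [0..<n] coords) \<beta> \<phi> r\<bar>\<^sup>2 * snd k r))"

definition D_topology_n :: "nat \<Rightarrow> ((nat \<Rightarrow> real^'d::finite) \<Rightarrow> real) topology" where
  "D_topology_n n = projective_topology (test_functions_n n) (H_norm_n n ` weight_index_n n)"

definition D_dual_n :: "nat \<Rightarrow> (((nat \<Rightarrow> real^'d::finite) \<Rightarrow> real) \<Rightarrow> real) set" where
  "D_dual_n n = topological_dual (test_functions_n n) (D_topology_n n)"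

section \<open>The spaces \<open>\<F>(\<D>'(\<real>\<^sup>d))\<close> and \<open>H\<^sub>-\<^sub>k\<^sup>\<otimes>\<^sup>n\<close>\<close>

definition symmetric_functional ::
  "nat \<Rightarrow> (((nat \<Rightarrow> real^'d::finite) \<Rightarrow> real) \<Rightarrow> real) \<Rightarrow> bool" where
  "symmetric_functional n T \<longleftrightarrow> (\<forall>\<pi> \<phi>. \<pi> permutes {..<n} \<longrightarrow> \<phi> \<in> test_functions_n n \<longrightarrow>
     T (\<lambda>x. \<phi> (x \<circ> \<pi>)) = T \<phi>)"

definition F_space :: "(nat \<Rightarrow> ((nat \<Rightarrow> real^'d::finite) \<Rightarrow> real) \<Rightarrow> real) set" where
  "F_space = {m. \<forall>n. m n \<in> D_dual_n n \<and> symmetric_functional n (m n)}"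

definition tensor ::
  "nat \<Rightarrow> (nat \<Rightarrow> real^'d::finite \<Rightarrow> real) \<Rightarrow> (nat \<Rightarrow> real^'d) \<Rightarrow> real" where
  "tensor n f x = (if x \<in> Rdn n then \<Prod>l<n. f l (x l) else 0)"

text \<open>The Hilbert space \<open>H\<^sub>k\<^sup>\<otimes>\<^sup>n\<close> is the completion of the algebraic tensor power of the
  test functions for the inner product with
  \<open>\<langle>f\<^sub>1 \<otimes> \<dots> \<otimes> f\<^sub>n, g\<^sub>1 \<otimes> \<dots> \<otimes> g\<^sub>n\<rangle> = \<langle>f\<^sub>1, g\<^sub>1\<rangle> \<cdots> \<langle>f\<^sub>n, g\<^sub>n\<rangle>\<close>.
  The norm of \<open>\<Sum>j<N. a j \<cdot> f j 0 \<otimes> \<dots> \<otimes> f j (n - 1)\<close> is \<open>tensor_norm k n N a f\<close>.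
  A functional belongs to its dual \<open>H\<^sub>-\<^sub>k\<^sup>\<otimes>\<^sup>n\<close> if it is bounded for this norm; the continuous
  extension to the completion is then unique.\<close>

definition tensor_norm ::
  "nat \<times> (real^'d::finite \<Rightarrow> real) \<Rightarrow> nat \<Rightarrow> nat \<Rightarrow> (nat \<Rightarrow> real) \<Rightarrow>
   (nat \<Rightarrow> nat \<Rightarrow> real^'d \<Rightarrow> real) \<Rightarrow> real" where
  "tensor_norm k n N a f =
     sqrt (\<Sum>i<N. \<Sum>j<N. a i * a j * (\<Prod>l<n. H_inner k (f i l) (f j l)))"

definition H_dual_tensor ::
  "nat \<times> (real^'d::finite \<Rightarrow> real) \<Rightarrow> nat \<Rightarrow> (((nat \<Rightarrow> real^'d) \<Rightarrow> real) \<Rightarrow> real) set" where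
  "H_dual_tensor k n = {T \<in> D_dual_n n. \<exists>C. \<forall>N a f.
     (\<forall>j<N. \<forall>l<n. f j l \<in> test_functions) \<longrightarrow>
     \<bar>T (\<lambda>x. \<Sum>j<N. a j * tensor n (f j) x)\<bar> \<le> C * tensor_norm k n N a f}"

section \<open>Quasi-analytic classes\<close>

definition C_class :: "(nat \<Rightarrow> real) \<Rightarrow> (real \<Rightarrow> real) set" where
  "C_class M = {f. (\<forall>n. ((deriv ^^ n) f) differentiable_on UNIV) \<and>
     (\<exists>\<beta>>0. \<exists>B>0. \<forall>n x. \<bar>(deriv ^^ n) f x\<bar> \<le> \<beta> * B ^ n * M n)}"

definition quasi_analytic :: "(nat \<Rightarrow> real) \<Rightarrow> bool" where
  "quasi_analytic M \<longleftrightarrow>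
     (\<forall>f \<in> C_class M. (\<forall>n. (deriv ^^ n) f 0 = 0) \<longrightarrow> (\<forall>x. f x = 0))"

end

theory Submission imports Defs begin

text \<open>
  Every \<open>f\<close> with compact support and \<open>\<bar>D\<^sup>\<beta>f\<bar> \<le> C B\<^bsup>\<bar>\<beta>\<bar>\<^esup> c(\<bar>\<beta>\<bar>)\<^sup>d\<close>, \<open>B < 1\<close>, is a multiple
  of an element of \<open>E\<close>: for all large \<open>n\<close> the ball of radius \<open>n\<close> contains its support, and a constant
  absorbs the remaining \<open>n\<close>. So it suffices to approximate a test function by such \<open>f\<close>.

  Let \<open>f\<close> be flat at \<open>0\<close> but not zero and in the class \<open>C{c\<^sub>n}\<close>. As \<open>c\<close> need not be logarithmically convex, the class
  need not be closed under products. Cut \<open>f\<close> off at \<open>0\<close> and multiply by \<open>e\<^bsup>-x\<^esup>\<close> to get a function \<open>H\<close> with square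
  integrable derivatives. Integration by parts shows that \<open>n \<mapsto> \<parallel>D\<^sup>nH\<parallel>\<^sub>2\<close> is logarithmically
  convex, so the derivatives of \<open>H(x) H(s - x)\<close>, a function with compact support, satisfy the
  right bounds in \<open>L\<^sup>1\<close>; the difference of two translates of a primitive satisfies
  them in the sup norm. Dilating makes \<open>B\<close> small.

  Functions of this kind remain so after multiplication by polynomials. If \<open>F\<close> is one with \<open>F(0) > 0\<close>,
  the products of \<open>(1 - (x\<^sub>i/r)\<^sup>2)\<^sup>m F(x\<^sub>i)\<close> over the coordinates \<open>i\<close> form an approximate identity up to
  normalization, as in Landau's proof of the Weierstrass theorem. Riemann sums of the convolution of
  a test function with it are linear combinations of translates and converge
  with all derivatives.
\<close>

section \<open>Functions of one variable\<close>

text \<open>\<open>F n\<close> plays the role of the n-th derivative of \<open>F 0\<close>. Carrying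
  the whole sequence lets every operation below come with an explicit formula for all
  derivatives.\<close>

definition deriv_seq :: "(nat \<Rightarrow> real \<Rightarrow> real) \<Rightarrow> bool" where
  "deriv_seq F \<longleftrightarrow> (\<forall>n x. (F n has_real_derivative F (Suc n) x) (at x))"

lemma deriv_seqD:
  "deriv_seq F \<Longrightarrow> (F n has_real_derivative F (Suc n) x) (at x)"
  by (simp add: deriv_seq_def)

lemma deriv_seq_higher_deriv:
  assumes "\<And>n. (deriv ^^ n) f differentiable_on UNIV"
  shows "deriv_seq (\<lambda>n. (deriv ^^ n) f)"
  unfolding deriv_seq_def
proof (intro allI)
  fix n x
  have "(deriv ^^ n) f field_differentiable at x"
    using assms[of n] unfolding differentiable_on_def real_differentiable_def field_differentiable_def
    by auto
  then show "((deriv ^^ n) f has_real_derivative (deriv ^^ Suc n) f x) (at x)"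
    by (simp add: field_differentiable_derivI)
qed

lemma deriv_seq_continuous_on: "deriv_seq F \<Longrightarrow> continuous_on A (F n)"
  by (meson DERIV_continuous_on deriv_seqD has_field_derivative_at_within)

lemma deriv_seq_measurable: "deriv_seq F \<Longrightarrow> F n \<in> borel_measurable borel"
  by (simp add: borel_measurable_continuous_onI deriv_seq_continuous_on)

lemma deriv_seq_affine:
  assumes "deriv_seq F"
  shows "deriv_seq (\<lambda>n x. a ^ n * F n (a * x + b))"
  unfolding deriv_seq_def
proof (intro allI)
  fix n x
  have "((\<lambda>x. F n (a * x + b)) has_real_derivative F (Suc n) (a * x + b) * a) (at x)"
    by (rule DERIV_chain2[OF deriv_seqD[OF assms]]) (rule derivative_eq_intros refl | simp)+
  from DERIV_cmult[OF this, of "a ^ n"]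
  show "((\<lambda>x. a ^ n * F n (a * x + b)) has_real_derivative a ^ Suc n * F (Suc n) (a * x + b)) (at x)"
    by (simp add: mult_ac)
qed

text \<open>Leibniz's formula: Pascal's rule regroups the derivative of the n-th sum into the sum
  for \<open>Suc n\<close>.\<close>

lemma deriv_seq_mult:
  assumes "deriv_seq F" "deriv_seq G"
  shows "deriv_seq (\<lambda>n x. \<Sum>k\<le>n. real (n choose k) * F k x * G (n - k) x)"
  unfolding deriv_seq_def
proof (intro allI)
  fix n x
  define a where "a = (\<lambda>k. F k x * G (Suc n - k) x)"
  have "((\<lambda>x. \<Sum>k\<le>n. real (n choose k) * F k x * G (n - k) x) has_real_derivative
     (\<Sum>k\<le>n. real (n choose k) * F (Suc k) x * G (n - k) x + G (Suc (n - k)) x * (real (n choose k) * F k x))) (at x)"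
    by (intro DERIV_sum DERIV_mult DERIV_cmult deriv_seqD assms)
  moreover have "(\<Sum>k\<le>n. real (n choose k) * F (Suc k) x * G (n - k) x + G (Suc (n - k)) x * (real (n choose k) * F k x))
      = (\<Sum>k\<le>n. real (n choose k) * a (Suc k)) + (\<Sum>k\<le>n. real (n choose k) * a k)"
    unfolding sum.distrib[symmetric] a_def
    by (rule sum.cong) (auto simp: Suc_diff_le algebra_simps)
  moreover have "(\<Sum>k\<le>Suc n. real (Suc n choose k) * a k) =
      a 0 + (\<Sum>k\<le>n. real (n choose k) * a (Suc k)) + (\<Sum>k\<le>n. real (n choose Suc k) * a (Suc k))"
    by (subst sum.atMost_Suc_shift) (simp add: sum.distrib algebra_simps)
  moreover have "(\<Sum>k\<le>n. real (n choose Suc k) * a (Suc k)) + a 0 = (\<Sum>k\<le>Suc n. real (n choose k) * a k)"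
    by (subst sum.atMost_Suc_shift) simp
  moreover have "(\<Sum>k\<le>Suc n. real (n choose k) * a k) = (\<Sum>k\<le>n. real (n choose k) * a k)"
    by simp
  ultimately have "((\<lambda>x. \<Sum>k\<le>n. real (n choose k) * F k x * G (n - k) x) has_real_derivative
       (\<Sum>k\<le>Suc n. real (Suc n choose k) * a k)) (at x)"
    by (metis (no_types, lifting) add.assoc add.commute)
  then show "((\<lambda>x. \<Sum>k\<le>n. real (n choose k) * F k x * G (n - k) x) has_real_derivative
       (\<Sum>k\<le>Suc n. real (Suc n choose k) * F k x * G (Suc n - k) x)) (at x)"
    by (simp only: a_def mult.assoc)
qed

lemma deriv_seq_lincomb:
  assumes "deriv_seq F" "deriv_seq G"
  shows "deriv_seq (\<lambda>n x. a * F n x + b * G n x)"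
  unfolding deriv_seq_def by (intro allI DERIV_add DERIV_cmult deriv_seqD assms)

lemma deriv_seq_times_id:
  assumes "deriv_seq F"
  shows "deriv_seq (\<lambda>n x. x * F n x + real n * F (n - 1) x)"
  unfolding deriv_seq_def
proof (intro allI)
  fix n x
  \<comment> \<open>For \<open>n = 0\<close> the truncated index \<open>n - 1\<close> is harmless,
    because the coefficient \<open>real n\<close> vanishes.\<close>
  have "((\<lambda>x. real n * F (n - 1) x) has_real_derivative real n * F n x) (at x)"
    using DERIV_cmult[OF deriv_seqD[OF assms], of "real n" "n - 1" x]
    by (cases n) (auto simp del: of_nat_Suc)
  from DERIV_add[OF DERIV_mult[OF DERIV_ident deriv_seqD[OF assms]] this]
  show "((\<lambda>x. x * F n x + real n * F (n - 1) x) has_real_derivative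
      x * F (Suc n) x + real (Suc n) * F (Suc n - 1) x) (at x)"
    by (simp add: algebra_simps)
qed

lemma deriv_seq_zero_on_open:
  assumes "deriv_seq F" "open S" "\<And>x. x \<in> S \<Longrightarrow> F 0 x = 0" "x \<in> S"
  shows "F n x = 0"
  using assms(4)
proof (induction n arbitrary: x)
  case (Suc n)
  have "((\<lambda>_. 0) has_real_derivative F (Suc n) x) (at x)"
    by (rule has_field_derivative_transform_within_open[OF deriv_seqD[OF assms(1), of n x] assms(2)])
      (use Suc in auto)
  then show ?case using DERIV_unique[OF _ DERIV_const] by blast
qed (use assms in auto)

text \<open>Only the point 0 needs an argument: the difference quotient of the cut function is
  dominated by that of \<open>F n\<close>, whose limit is \<open>F (Suc n) 0 = 0\<close>.\<close>

lemma deriv_seq_cut_at_flat_point: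
  assumes "deriv_seq F" "\<And>n. F n 0 = 0"
  shows "deriv_seq (\<lambda>n x. if 0 < x then F n x else 0)"
  unfolding deriv_seq_def
proof (intro allI)
  fix n x
  show "((\<lambda>x. if 0 < x then F n x else 0) has_real_derivative (if 0 < x then F (Suc n) x else 0)) (at x)"
  proof (rule linorder_cases[of x 0])
    assume "x < 0"
    have "((\<lambda>x. if 0 < x then F n x else 0) has_real_derivative 0) (at x)"
      by (rule has_field_derivative_transform_within_open[OF DERIV_const, of "{..<0}"])
        (use \<open>x < 0\<close> in auto)
    then show ?thesis using \<open>x < 0\<close> by simp
  next
    assume "x > 0"
    have "((\<lambda>x. if 0 < x then F n x else 0) has_real_derivative F (Suc n) x) (at x)"
      by (rule has_field_derivative_transform_within_open[OF deriv_seqD[OF assms(1)], of "{0<..}"])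
        (use \<open>x > 0\<close> in auto)
    then show ?thesis using \<open>x > 0\<close> by simp
  next
    assume x: "x = 0"
    have "((\<lambda>h. F n h / h) \<longlongrightarrow> 0) (at 0)"
      using deriv_seqD[OF assms(1), of n 0] by (simp add: DERIV_def assms(2))
    then have "((\<lambda>h. (if 0 < h then F n h else 0) / h) \<longlongrightarrow> 0) (at 0)"
      by (rule Lim_null_comparison[where g = "\<lambda>h. \<bar>F n h / h\<bar>", rotated, OF tendsto_rabs_zero])
        (auto intro!: always_eventually simp: divide_nonneg_nonpos)
    then show ?thesis by (simp add: x DERIV_def cong: if_cong)
  qed
qed

section \<open>Integration by parts, Cauchy-Schwarz and logarithmic convexity\<close>

text \<open>Translation invariance makes the integral of every difference quotient of
  \<open>u\<close> zero. The mean value theorem bounds the quotients by \<open>w\<close>, and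
  dominated convergence passes to the limit. Applied to a product, this is integration by parts
  without boundary terms, on the line or along a coordinate axis.\<close>

lemma integral_directional_derivative_eq_0:
  fixes u u' w :: "'a::euclidean_space \<Rightarrow> real"
  assumes u: "integrable lborel u"
    and u': "u' \<in> borel_measurable borel"
    and w: "integrable lborel w"
    and deriv: "\<And>x t. ((\<lambda>t. u (x + t *\<^sub>R e)) has_real_derivative u' (x + t *\<^sub>R e)) (at t)"
    and bound: "\<And>x t. 0 \<le> t \<Longrightarrow> t \<le> 1 \<Longrightarrow> \<bar>u' (x + t *\<^sub>R e)\<bar> \<le> w x"
  shows "(\<integral>x. u' x \<partial>lborel) = 0"
proof -
  define t where "t n = 1 / real (Suc n)" for n
  define q where "q n x = (u (x + t n *\<^sub>R e) - u x) / t n" for n x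
  have t: "0 < t n" "t n \<le> 1" for n by (auto simp: t_def)
  have "t \<longlonglongrightarrow> 0"
    unfolding t_def by (rule LIMSEQ_Suc[OF lim_1_over_n])
  then have t0: "filterlim t (at 0) sequentially"
    unfolding filterlim_at using t(1) by (auto simp: less_imp_neq[symmetric])
  have shifted: "integrable lborel (\<lambda>x. u (x + v))" "(\<integral>x. u (x + v) \<partial>lborel) = (\<integral>x. u x \<partial>lborel)" for v
  proof -
    have "(\<lambda>x. x + v) = (+) v" by (auto simp: add.commute)
    then have *: "lborel = distr lborel borel (\<lambda>x. x + v)"
      by (simp add: lborel_distr_plus)
    show "integrable lborel (\<lambda>x. u (x + v))"
      using u by (subst (asm) *) (simp add: integrable_distr_eq borel_measurable_integrable[OF u, simplified])
    show "(\<integral>x. u (x + v) \<partial>lborel) = (\<integral>x. u x \<partial>lborel)"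
      by (subst (2) *) (use borel_measurable_integrable[OF u] in \<open>simp add: integral_distr\<close>)
  qed
  have "(\<integral>x. q n x \<partial>lborel) = 0" for n
    unfolding q_def using shifted[of "t n *\<^sub>R e"] u by simp
  moreover have "(\<lambda>n. \<integral>x. q n x \<partial>lborel) \<longlonglongrightarrow> (\<integral>x. u' x \<partial>lborel)"
  proof (rule integral_dominated_convergence[where w = w])
    show "q n \<in> borel_measurable lborel" for n
      unfolding q_def using shifted(1)[of "t n *\<^sub>R e"] u
      by (auto intro!: borel_measurable_divide borel_measurable_diff dest: borel_measurable_integrable)
    show "AE x in lborel. (\<lambda>n. q n x) \<longlonglongrightarrow> u' x"
    proof (intro AE_I2)
      fix x
      have "((\<lambda>h. (u (x + h *\<^sub>R e) - u x) / h) \<longlongrightarrow> u' x) (at 0)"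
        using deriv[of x 0] by (simp add: DERIV_def)
      from filterlim_compose[OF this t0] show "(\<lambda>n. q n x) \<longlonglongrightarrow> u' x"
        by (simp add: q_def)
    qed
    show "AE x in lborel. norm (q n x) \<le> w x" for n
    proof (intro AE_I2)
      fix x
      obtain z where z: "0 < z" "z < t n"
        "u (x + t n *\<^sub>R e) - u (x + 0 *\<^sub>R e) = (t n - 0) * u' (x + z *\<^sub>R e)"
        using MVT2[OF t(1)[of n], of "\<lambda>t. u (x + t *\<^sub>R e)" "\<lambda>t. u' (x + t *\<^sub>R e)"] deriv by blast
      then have "q n x = u' (x + z *\<^sub>R e)"
        using t[of n] by (simp add: q_def)
      then show "norm (q n x) \<le> w x" using bound[of z x] z t[of n] by simp
    qed
  qed (use u' w in auto)
  ultimately show ?thesis by (simp add: LIMSEQ_const_iff)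
qed

lemma Cauchy_Schwarz_integral:
  fixes u v :: "'a \<Rightarrow> real"
  assumes "integrable M (\<lambda>x. (u x)\<^sup>2)" "integrable M (\<lambda>x. (v x)\<^sup>2)" "integrable M (\<lambda>x. u x * v x)"
  shows "(\<integral>x. u x * v x \<partial>M)\<^sup>2 \<le> (\<integral>x. (u x)\<^sup>2 \<partial>M) * (\<integral>x. (v x)\<^sup>2 \<partial>M)"
proof -
  define A B C where "A = (\<integral>x. (u x)\<^sup>2 \<partial>M)" "B = (\<integral>x. (v x)\<^sup>2 \<partial>M)" "C = (\<integral>x. u x * v x \<partial>M)"
  have q: "0 \<le> A - 2 * t * C + t\<^sup>2 * B" for t
  proof -
    have "0 \<le> (\<integral>x. (u x - t * v x)\<^sup>2 \<partial>M)" by simp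
    also have "\<dots> = (\<integral>x. (u x)\<^sup>2 - 2 * t * (u x * v x) + t\<^sup>2 * (v x)\<^sup>2 \<partial>M)"
      by (simp add: power2_eq_square algebra_simps)
    also have "\<dots> = A - 2 * t * C + t\<^sup>2 * B"
      using assms by (simp add: A_B_C_def)
    finally show ?thesis .
  qed
  have "0 \<le> A" "0 \<le> B" by (auto simp: A_B_C_def)
  show ?thesis
  proof (cases "B = 0")
    case True
    \<comment> \<open>With \<open>B = 0\<close> the quadratic is affine in \<open>t\<close>; at
      \<open>t = (A + 1) / (2 * C)\<close> it would equal -1.\<close>
    have "C = 0"
      using q[of "(A + 1) / (2 * C)"] True by (cases "C = 0") auto
    then show ?thesis using True by (simp add: A_B_C_def)
  next
    case False
    then have "0 < B" using \<open>0 \<le> B\<close> by simp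
    then have "0 \<le> (A - 2 * (C / B) * C + (C / B)\<^sup>2 * B) * B"
      using q[of "C / B"] by simp
    also have "\<dots> = A * B - C\<^sup>2"
      using \<open>0 < B\<close> by (simp add: field_simps power2_eq_square)
    finally show ?thesis by (simp add: A_B_C_def)
  qed
qed

text \<open>The hypothesis says that the ratios \<open>b (Suc n) / b n\<close> increase, so the
  product of the first \<open>k\<close> of them is at most the product of the \<open>k\<close>
  ratios starting at \<open>l\<close>. A zero at a positive index spreads to all positive indices
  and is treated apart, since \<open>b 0\<close> may still be positive.\<close>

lemma log_convex_product:
  fixes b :: "nat \<Rightarrow> real"
  assumes nn: "\<And>n. 0 \<le> b n" and cv: "\<And>n. (b (Suc n))\<^sup>2 \<le> b n * b (Suc (Suc n))"
  shows "b k * b l \<le> b 0 * b (k + l)"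
proof (cases "\<exists>j. b (Suc j) = 0")
  case True
  then obtain j where j: "b (Suc j) = 0" by auto
  have down: "b (Suc n) = 0" if "b (Suc (Suc n)) = 0" for n
    using cv[of n] that by simp
  have up: "b (Suc (Suc n)) = 0" if "b (Suc n) = 0" for n
    using cv[of "Suc n"] that by simp
  have "b (Suc 0) = 0"
    using j down by (induction j) auto
  then have "b (Suc n) = 0" for n
    using up by (induction n) auto
  then show ?thesis using nn by (cases k; cases l) auto
next
  case False
  then have pos: "0 < b (Suc n)" for n using nn[of "Suc n"] by (metis less_eq_real_def)
  have "0 < b 0"
    using cv[of 0] pos[of 0] nn[of 0] by (metis less_eq_real_def mult_zero_left not_le power2_less_eq_zero_iff zero_less_power2)
  with pos have pos: "0 < b n" for n by (cases n) auto
  define r where "r n = b (Suc n) / b n" for n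
  have r0: "0 < r n" for n using pos by (simp add: r_def)
  have "r n \<le> r (Suc n)" for n
    using cv[of n] pos[of n] pos[of "Suc n"] by (simp add: r_def field_simps power2_eq_square)
  then have mono: "r m \<le> r n" if "m \<le> n" for m n
    using that lift_Suc_mono_le by blast
  have step: "b (Suc n) = r n * b n" for n using pos[of n] by (simp add: r_def)
  show ?thesis
  proof (induction k)
    case (Suc k)
    have "b (Suc k) * b l = r k * (b k * b l)" by (simp add: step)
    also have "\<dots> \<le> r (k + l) * (b 0 * b (k + l))"
      by (rule mult_mono[OF mono Suc]) (auto simp: r0 nn less_imp_le)
    also have "\<dots> = b 0 * b (Suc k + l)" by (simp add: step)
    finally show ?case .
  qed simp
qed

lemma exp_half_line_integrable:
  "integrable lborel (\<lambda>x. indicator {a..} x * exp (- (2 * x)) :: real)"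
proof -
  have "(\<lambda>x::real. exp (- (2 * x))) integrable_on {a..}"
    using has_integral_exp_minus_to_infinity[of 2 a] by (auto simp: integrable_on_def)
  then have "set_integrable lebesgue {a..} (\<lambda>x::real. exp (- (2 * x)))"
    by (rule nonnegative_absolutely_integrable_1) simp
  then have "integrable lebesgue (\<lambda>x. indicator {a..} x * exp (- (2 * x)) :: real)"
    by (simp add: set_integrable_def)
  then show ?thesis
    by (subst (asm) integrable_completion) auto
qed

section \<open>A compactly supported function from a non-quasi-analytic class\<close>

text \<open>The point is that the bound contains \<open>c n\<close> only once, although a product of
  two functions is used. Products \<open>c k * c (n - k)\<close> are avoided by passing through
  square integrals. The order lost in returning to the sup norm is regained by taking a
  primitive.\<close>

lemma not_quasi_analytic_compact_support:
  assumes c: "\<And>n. 0 < c n" "incseq c" and nqa: "\<not> quasi_analytic c"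
  obtains K B C R p where "deriv_seq K" "0 < B" "\<And>n x. \<bar>K n x\<bar> \<le> C * B ^ n * c n"
    "\<And>n x. R < \<bar>x\<bar> \<Longrightarrow> K n x = 0" "K 0 p \<noteq> 0"
proof -
  obtain f x0 \<beta> B where f: "\<And>n. (deriv ^^ n) f differentiable_on UNIV" "0 < \<beta>" "0 < B"
     "\<And>n x. \<bar>(deriv ^^ n) f x\<bar> \<le> \<beta> * B ^ n * c n" "\<And>n. (deriv ^^ n) f 0 = 0" "f x0 \<noteq> 0"
    using nqa unfolding quasi_analytic_def C_class_def by blast
  define p where "p = \<bar>x0\<bar>"
  have "x0 \<noteq> 0" using f(5)[of 0] f(6) by auto
  then have p: "0 < p" by (simp add: p_def)
  \<comment> \<open>The sign reflects the line if necessary, so that the point \<open>p\<close> of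
    nonvanishing is positive and survives the cut.\<close>
  define F where "F n x = sgn x0 ^ n * (deriv ^^ n) f (sgn x0 * x + 0)" for n x
  have F: "deriv_seq F"
    unfolding F_def[abs_def] by (intro deriv_seq_affine deriv_seq_higher_deriv f)
  have F_bound: "\<bar>F n x\<bar> \<le> \<beta> * B ^ n * c n" for n x
    using f(4)[of n "sgn x0 * x"] \<open>x0 \<noteq> 0\<close> by (simp add: F_def abs_mult power_abs abs_sgn_eq)
  have F_p: "F 0 p \<noteq> 0"
    using f(6) by (simp add: F_def p_def sgn_mult_abs)
  define G where "G n x = (if 0 < x then F n x else 0)" for n x
  have G: "deriv_seq G"
    unfolding G_def[abs_def] by (rule deriv_seq_cut_at_flat_point[OF F]) (simp add: F_def f)
  define e where "e n x = (-1) ^ n * exp (- x)" for n and x :: real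
  have e: "deriv_seq e"
    unfolding deriv_seq_def e_def by (auto intro!: derivative_eq_intros)
  define H where "H n x = (\<Sum>k\<le>n. real (n choose k) * G k x * e (n - k) x)" for n x
  have H: "deriv_seq H"
    unfolding H_def[abs_def] by (rule deriv_seq_mult[OF G e])
  have H0: "H n x = 0" if "x \<le> 0" for n x
    using that by (simp add: H_def G_def)
  define D where "D n = \<beta> * (B + 1) ^ n * c n" for n
  have D0: "0 < D n" for n using f c by (simp add: D_def)
  define h where "h x = indicator {0..} x * exp (- x)" for x :: real
  have H_bound: "\<bar>H n x\<bar> \<le> D n * h x" for n x
  proof (cases "x \<le> 0")
    case False
    have "\<bar>H n x\<bar> \<le> (\<Sum>k\<le>n. \<bar>real (n choose k) * G k x * e (n - k) x\<bar>)"
      unfolding H_def by (rule sum_abs)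
    \<comment> \<open>Monotonicity replaces \<open>c k\<close> by \<open>c n\<close>; the factor
      \<open>1 ^ (n - k)\<close> prepares the binomial theorem, which produces the
      \<open>B + 1\<close> in \<open>D\<close>.\<close>
    also have "\<dots> \<le> (\<Sum>k\<le>n. (\<beta> * c n * exp (-x)) * (real (n choose k) * B ^ k * 1 ^ (n - k)))"
    proof (rule sum_mono)
      fix k assume "k \<in> {..n}"
      have "\<bar>G k x\<bar> \<le> \<beta> * B ^ k * c n"
        using \<open>k \<in> {..n}\<close> False f(2,3) incseqD[OF c(2), of k n]
        by (auto simp: G_def intro!: order_trans[OF F_bound] mult_left_mono)
      then have "real (n choose k) * \<bar>G k x\<bar> * exp (-x) \<le> real (n choose k) * (\<beta> * B ^ k * c n) * exp (-x)"
        by (intro mult_right_mono mult_left_mono) auto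
      then show "\<bar>real (n choose k) * G k x * e (n - k) x\<bar> \<le> (\<beta> * c n * exp (-x)) * (real (n choose k) * B ^ k * 1 ^ (n - k))"
        by (simp add: e_def abs_mult power_abs mult_ac)
    qed
    also have "\<dots> = \<beta> * c n * exp (-x) * (B + 1) ^ n"
      by (simp only: binomial_ring[of B 1 n] sum_distrib_left mult.assoc)
    finally show ?thesis using False by (simp add: D_def h_def mult_ac)
  qed (use D0 in \<open>simp add: H0 h_def less_imp_le\<close>)
  have h2: "h x * h x = indicator {0..} x * exp (- (2 * x))" for x
    by (auto simp: h_def indicator_def exp_add[symmetric])
  have h2_int: "integrable lborel (\<lambda>x. h x * h x)"
    unfolding h2 by (rule exp_half_line_integrable)
  define I where "I = (\<integral>x. h x * h x \<partial>lborel)"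
  have h0: "0 \<le> h x" for x by (simp add: h_def)
  have HH_bound: "\<bar>H k x * H l x\<bar> \<le> D k * D l * (h x * h x)" for k l x
    using mult_mono[OF H_bound[of k x] H_bound[of l x]] h0[of x] D0[of k]
    by (simp add: abs_mult mult_ac less_imp_le)
  have H_meas [measurable]: "H n \<in> borel_measurable borel" for n
    by (rule deriv_seq_measurable[OF H])
  have HH_int: "integrable lborel (\<lambda>x. H k x * H l x)" for k l
    by (rule Bochner_Integration.integrable_bound[of _ "\<lambda>x. D k * D l * (h x * h x)"])
      (use HH_bound[of k _ l] in \<open>auto intro!: h2_int AE_I2 order_trans[OF _ abs_ge_self]\<close>)
  define b where "b n = (\<integral>x. (H n x)\<^sup>2 \<partial>lborel)" for n
  have b0: "0 \<le> b n" for n by (simp add: b_def)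
  have b_bound: "b n \<le> (D n)\<^sup>2 * I" for n
  proof -
    have "b n \<le> (\<integral>x. (D n)\<^sup>2 * (h x * h x) \<partial>lborel)"
      unfolding b_def using HH_bound[of n _ n] HH_int[of n n] h2_int
      by (intro integral_mono) (auto simp: power2_eq_square)
    then show ?thesis by (simp add: I_def)
  qed
  \<comment> \<open>Integrating the derivative of \<open>H n * H (Suc n)\<close> gives
    \<open>b (Suc n)\<close> as minus the integral of \<open>H n * H (Suc (Suc n))\<close>;
    Cauchy-Schwarz does the rest.\<close>
  have b_conv: "(b (Suc n))\<^sup>2 \<le> b n * b (Suc (Suc n))" for n
  proof -
    \<comment> \<open>The half-line starts at -1 because a shift by \<open>t \<le> 1\<close> can
      move a point from there into the support of \<open>h\<close>.\<close>
    define w where "w x = (D (Suc n) * D (Suc n) + D n * D (Suc (Suc n))) * (indicator {-1..} x * exp (- (2 * x)))" for x :: real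
    have "(\<integral>x. H (Suc n) x * H (Suc n) x + H n x * H (Suc (Suc n)) x \<partial>lborel) = 0"
    proof (rule integral_directional_derivative_eq_0[where e = 1 and w = w and u = "\<lambda>x. H n x * H (Suc n) x"])
      show "integrable lborel w"
        unfolding w_def by (intro integrable_mult_right exp_half_line_integrable)
      fix x t :: real
      have shift: "((\<lambda>t. H k (x + t *\<^sub>R 1)) has_real_derivative H (Suc k) (x + t *\<^sub>R 1)) (at t)" for k
        using DERIV_chain2[OF deriv_seqD[OF H, of k "x + t"] DERIV_add[OF DERIV_const DERIV_ident]] by simp
      show "((\<lambda>t. H n (x + t *\<^sub>R 1) * H (Suc n) (x + t *\<^sub>R 1)) has_real_derivative
            H (Suc n) (x + t *\<^sub>R 1) * H (Suc n) (x + t *\<^sub>R 1) + H n (x + t *\<^sub>R 1) * H (Suc (Suc n)) (x + t *\<^sub>R 1)) (at t)"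
        using DERIV_mult[OF shift[of n] shift[of "Suc n"]] by (simp add: algebra_simps)
      assume t: "0 \<le> t" "t \<le> 1"
      have "h (x + t) * h (x + t) \<le> indicator {-1..} x * exp (- (2 * x))"
        unfolding h2 using t by (auto simp: indicator_def)
      then have "(D (Suc n) * D (Suc n) + D n * D (Suc (Suc n))) * (h (x + t) * h (x + t)) \<le> w x"
        unfolding w_def by (intro mult_left_mono) (auto simp: D0 less_imp_le)
      then show "\<bar>H (Suc n) (x + t *\<^sub>R 1) * H (Suc n) (x + t *\<^sub>R 1) + H n (x + t *\<^sub>R 1) * H (Suc (Suc n)) (x + t *\<^sub>R 1)\<bar> \<le> w x"
        using HH_bound[of "Suc n" "x + t" "Suc n"] HH_bound[of n "x + t" "Suc (Suc n)"]
        unfolding distrib_right real_scaleR_def mult_1_right by linarith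
    qed (use HH_int in auto)
    then have "b (Suc n) = - (\<integral>x. H n x * H (Suc (Suc n)) x \<partial>lborel)"
      using HH_int by (simp add: b_def power2_eq_square)
    then have "(b (Suc n))\<^sup>2 = (\<integral>x. H n x * H (Suc (Suc n)) x \<partial>lborel)\<^sup>2"
      by simp
    also have "\<dots> \<le> b n * b (Suc (Suc n))"
      unfolding b_def by (rule Cauchy_Schwarz_integral) (use HH_int in \<open>simp_all add: power2_eq_square\<close>)
    finally show ?thesis .
  qed
  \<comment> \<open>With this choice \<open>p\<close> is fixed by the reflection, so
    \<open>H 0 x * H 0 (s - x)\<close> takes the nonzero value \<open>(H 0 p)\<^sup>2\<close> at
    \<open>p\<close>.\<close>
  define s where "s = 2 * p"
  have refl_int: "integrable lborel (\<lambda>x. (H l (s - x))\<^sup>2)" "(\<integral>x. (H l (s - x))\<^sup>2 \<partial>lborel) = b l" for l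
    using lborel_integrable_real_affine[of "\<lambda>x. (H l x)\<^sup>2" "-1" s] HH_int[of l l]
      lborel_integral_real_affine[of "-1" "\<lambda>x. (H l x)\<^sup>2" s]
    by (simp_all add: power2_eq_square b_def)
  have cross_int: "integrable lborel (\<lambda>x. H k x * H l (s - x))" for k l
  proof (rule Bochner_Integration.integrable_bound)
    show "integrable lborel (\<lambda>x. (H k x)\<^sup>2 + (H l (s - x))\<^sup>2)"
      using refl_int(1)[of l] HH_int[of k k] by (auto simp: power2_eq_square)
    show "AE x in lborel. norm (H k x * H l (s - x)) \<le> norm ((H k x)\<^sup>2 + (H l (s - x))\<^sup>2)"
    proof (intro AE_I2)
      fix x
      have "\<bar>u * v\<bar> \<le> \<bar>u\<^sup>2 + v\<^sup>2\<bar>" for u v :: real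
        using sum_squares_bound[of "\<bar>u\<bar>" "\<bar>v\<bar>"] mult_nonneg_nonneg[of "\<bar>u\<bar>" "\<bar>v\<bar>"]
        unfolding abs_mult power2_abs by linarith
      then show "norm (H k x * H l (s - x)) \<le> norm ((H k x)\<^sup>2 + (H l (s - x))\<^sup>2)"
        by simp
    qed
  qed auto
  \<comment> \<open>Cauchy-Schwarz followed by logarithmic convexity merges the orders
    \<open>k\<close> and \<open>l\<close> into the single order \<open>k + l\<close>, and hence into
    one factor \<open>D (k + l)\<close>.\<close>
  have cross: "(\<integral>x. \<bar>H k x * H l (s - x)\<bar> \<partial>lborel) \<le> sqrt (b 0) * (D (k + l) * sqrt I)" for k l
  proof -
    have "(\<integral>x. \<bar>H k x\<bar> * \<bar>H l (s - x)\<bar> \<partial>lborel)\<^sup>2 \<le> (\<integral>x. \<bar>H k x\<bar>\<^sup>2 \<partial>lborel) * (\<integral>x. \<bar>H l (s - x)\<bar>\<^sup>2 \<partial>lborel)"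
      by (rule Cauchy_Schwarz_integral)
        (use refl_int(1)[of l] HH_int[of k k] integrable_abs[OF cross_int[of k l]] in \<open>simp_all add: power2_eq_square abs_mult\<close>)
    also have "\<dots> = b k * b l"
      using refl_int(2)[of l] by (simp add: b_def)
    also have "\<dots> \<le> b 0 * b (k + l)"
      by (rule log_convex_product) (use b0 b_conv in auto)
    also have "\<dots> \<le> b 0 * ((D (k + l))\<^sup>2 * I)"
      by (rule mult_left_mono[OF b_bound b0])
    finally have "(\<integral>x. \<bar>H k x * H l (s - x)\<bar> \<partial>lborel) \<le> sqrt (b 0 * ((D (k + l))\<^sup>2 * I))"
      by (intro real_le_rsqrt) (simp add: abs_mult)
    then show ?thesis using D0[of "k + l"] by (simp add: real_sqrt_mult)
  qed
  \<comment> \<open>The n-th derivative of \<open>H 0 x * H 0 (s - x)\<close>. It vanishes outside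
    the interval from 0 to \<open>s\<close>, since \<open>H\<close> vanishes on the negative
    half-line.\<close>
  define Q where "Q n x = (\<Sum>k\<le>n. real (n choose k) * H k x * ((-1) ^ (n - k) * H (n - k) (-1 * x + s)))" for n x
  have Q: "deriv_seq Q"
    unfolding Q_def[abs_def] by (rule deriv_seq_mult[OF H deriv_seq_affine[OF H]])
  have Q0: "Q n x = 0" if "x \<le> 0 \<or> s \<le> x" for n x
    using that H0 by (auto simp: Q_def)
  have Q_abs: "\<bar>Q n x\<bar> \<le> (\<Sum>k\<le>n. real (n choose k) * \<bar>H k x * H (n - k) (s - x)\<bar>)" for n x
    unfolding Q_def by (rule order_trans[OF sum_abs]) (simp add: abs_mult power_abs mult_ac)
  have Q_L1: "(\<integral>x. \<bar>Q n x\<bar> \<partial>lborel) \<le> 2 ^ n * (sqrt (b 0) * (D n * sqrt I))" and Q_int: "integrable lborel (Q n)" for n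
  proof -
    have int: "integrable lborel (\<lambda>x. \<Sum>k\<le>n. real (n choose k) * \<bar>H k x * H (n - k) (s - x)\<bar>)"
      using cross_int by auto
    show Q_int: "integrable lborel (Q n)"
      by (rule Bochner_Integration.integrable_bound[OF int])
        (use Q_abs[of n] deriv_seq_measurable[OF Q] in \<open>auto intro!: AE_I2 order_trans[OF _ abs_ge_self]\<close>)
    have "(\<integral>x. \<bar>Q n x\<bar> \<partial>lborel) \<le> (\<integral>x. (\<Sum>k\<le>n. real (n choose k) * \<bar>H k x * H (n - k) (s - x)\<bar>) \<partial>lborel)"
      using int Q_int Q_abs[of n] by (intro integral_mono) auto
    also have "\<dots> = (\<Sum>k\<le>n. real (n choose k) * (\<integral>x. \<bar>H k x * H (n - k) (s - x)\<bar> \<partial>lborel))"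
      using cross_int by (subst Bochner_Integration.integral_sum) auto
    also have "\<dots> \<le> (\<Sum>k\<le>n. real (n choose k) * (sqrt (b 0) * (D n * sqrt I)))"
    proof (intro sum_mono mult_left_mono)
      fix k assume "k \<in> {..n}"
      then show "(\<integral>x. \<bar>H k x * H (n - k) (s - x)\<bar> \<partial>lborel) \<le> sqrt (b 0) * (D n * sqrt I)"
        using cross[of k "n - k"] by simp
    qed simp
    also have "\<dots> = 2 ^ n * (sqrt (b 0) * (D n * sqrt I))"
      unfolding sum_distrib_right[symmetric] of_nat_sum[symmetric] choose_row_sum by simp
    finally show "(\<integral>x. \<bar>Q n x\<bar> \<partial>lborel) \<le> 2 ^ n * (sqrt (b 0) * (D n * sqrt I))" .
  qed
  \<comment> \<open>\<open>Q n\<close> is the integral of \<open>Q (Suc n)\<close> from 0, so the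
    sup norm costs one order: \<open>D (Suc n)\<close> appears instead of
    \<open>D n\<close>.\<close>
  have Q_bound: "\<bar>Q n x\<bar> \<le> 2 ^ Suc n * (sqrt (b 0) * (D (Suc n) * sqrt I))" for n x
  proof (cases "0 \<le> x")
    case True
    have "(Q (Suc n) has_integral Q n x - Q n 0) {0..x}"
      by (rule fundamental_theorem_of_calculus[OF True])
        (use deriv_seqD[OF Q] in \<open>simp add: has_field_derivative_at_within has_real_derivative_iff_has_vector_derivative[symmetric]\<close>)
    then have "\<bar>Q n x\<bar> = norm (integral {0..x} (Q (Suc n)))"
      by (simp add: integral_unique Q0)
    also have "\<dots> \<le> integral {0..x} (\<lambda>x. \<bar>Q (Suc n) x\<bar>)"
      by (rule integral_norm_bound_integral)
        (auto intro!: integrable_continuous_interval continuous_intros deriv_seq_continuous_on[OF Q])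
    also have "\<dots> \<le> integral UNIV (\<lambda>x. \<bar>Q (Suc n) x\<bar>)"
      by (rule integral_subset_le)
        (auto intro!: integrable_continuous_interval continuous_intros deriv_seq_continuous_on[OF Q] integrable_on_lborel Q_int)
    also have "\<dots> = (\<integral>x. \<bar>Q (Suc n) x\<bar> \<partial>lborel)"
      by (simp add: integral_lborel Q_int)
    also note Q_L1
    finally show ?thesis .
  next
    case False
    have "0 \<le> I" by (simp add: I_def)
    with False show ?thesis using D0[of "Suc n"] b0[of 0] by (simp add: Q0)
  qed
  obtain P where P: "\<And>x. (P has_real_derivative Q 0 x) (at x)"
    using einterval_antiderivative[of "-\<infinity>" "\<infinity>" "Q 0"] DERIV_isCont[OF deriv_seqD[OF Q]]
    by (auto simp: has_real_derivative_iff_has_vector_derivative)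
  \<comment> \<open>Since \<open>K (Suc m)\<close> is made from \<open>Q m\<close>, the shift of
    order in \<open>Q_bound\<close> is undone. A primitive \<open>P\<close> alone need not have
    compact support, but it is constant on either side of the support of \<open>Q 0\<close>, so the
    difference of two translates does.\<close>
  define K where "K n x = (case n of 0 \<Rightarrow> P x - P (x - s) | Suc m \<Rightarrow> Q m x - Q m (x - s))" for n x
  have K: "deriv_seq K"
    unfolding deriv_seq_def
  proof (intro allI)
    fix n x
    have P': "((\<lambda>x. P (x - s)) has_real_derivative Q 0 (x - s)) (at x)"
      using DERIV_chain2[OF P[of "x - s"] DERIV_diff[OF DERIV_ident DERIV_const]] by simp
    have Q': "((\<lambda>x. Q m (x - s)) has_real_derivative Q (Suc m) (x - s)) (at x)" for m
      using DERIV_chain2[OF deriv_seqD[OF Q, of m "x - s"] DERIV_diff[OF DERIV_ident DERIV_const]] by simp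
    show "(K n has_real_derivative K (Suc n) x) (at x)"
      using DERIV_diff[OF P P'] DERIV_diff[OF deriv_seqD[OF Q] Q'] by (cases n) (auto simp: K_def[abs_def])
  qed
  have s: "0 < s" using p by (simp add: s_def)
  have P_const: "P x = P y" if "convex S" "x \<in> S" "y \<in> S" "\<And>z. z \<in> S \<Longrightarrow> Q 0 z = 0" for S x y
  proof -
    have "\<exists>k. \<forall>z\<in>S. P z = k"
      using P that(4) by (intro has_field_derivative_zero_constant that(1)) (metis has_field_derivative_at_within)
    then show ?thesis using that by auto
  qed
  have P_left: "P x = P 0" if "x \<le> 0" for x
    using that Q0 by (intro P_const[of "{..0}"]) auto
  have P_right: "P x = P s" if "s \<le> x" for x
    using that Q0 by (intro P_const[of "{s..}"]) auto
  have K_supp: "K n x = 0" if "2 * s < \<bar>x\<bar>" for n x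
    using that s P_left[of x] P_left[of "x - s"] P_right[of x] P_right[of "x - s"] Q0
    by (cases "x < 0"; cases n) (auto simp: K_def)
  \<comment> \<open>If \<open>K 0\<close> were zero, so would be
    \<open>K 1 p = Q 0 p - Q 0 (p - s)\<close>. Here \<open>p - s = - p\<close> lies outside the
    support, and \<open>Q 0 p\<close> is a nonzero square.\<close>
  have "\<exists>q. K 0 q \<noteq> 0"
  proof (rule ccontr)
    assume "\<not> ?thesis"
    then have "K 1 p = 0"
      using deriv_seq_zero_on_open[OF K open_UNIV] by blast
    then have "Q 0 p = 0"
      using Q0[of "p - s" 0] p by (simp add: K_def s_def)
    then show False
      using F_p p by (simp add: Q_def H_def G_def e_def s_def)
  qed
  then obtain q where q: "K 0 q \<noteq> 0" by auto
  have "compact (K 0 ` cball 0 (2 * s))"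
    by (intro compact_continuous_image deriv_seq_continuous_on[OF K] compact_cball)
  then obtain M where M: "\<And>x. x \<in> cball 0 (2 * s) \<Longrightarrow> \<bar>K 0 x\<bar> \<le> M"
    using compact_imp_bounded[of "K 0 ` cball 0 (2 * s)"] unfolding bounded_iff
    by (metis imageI real_norm_def)
  have K0_bound: "\<bar>K 0 x\<bar> \<le> \<bar>M\<bar>" for x
    using M[of x] K_supp[of x 0] by (cases "x \<in> cball 0 (2 * s)") auto
  define A where "A = 2 * (sqrt (b 0) * (\<beta> * sqrt I))"
  \<comment> \<open>Order 0 is not reached by \<open>Q_bound\<close>; there the compactness bound
    \<open>M\<close>, divided by \<open>c 0\<close>, enters the constant.\<close>
  have "\<bar>K n x\<bar> \<le> max A (\<bar>M\<bar> / c 0) * (2 * (B + 1)) ^ n * c n" for n x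
  proof (cases n)
    case 0
    have "\<bar>M\<bar> \<le> max A (\<bar>M\<bar> / c 0) * c 0"
      using c(1)[of 0] by (subst pos_divide_le_eq[symmetric]) auto
    then show ?thesis using K0_bound[of x] 0 by simp
  next
    case (Suc m)
    have "\<bar>K n x\<bar> \<le> \<bar>Q m x\<bar> + \<bar>Q m (x - s)\<bar>" by (simp add: K_def Suc)
    also have "\<dots> \<le> 2 * (2 ^ Suc m * (sqrt (b 0) * (D (Suc m) * sqrt I)))"
      using Q_bound[of m x] Q_bound[of m "x - s"] by simp
    also have "\<dots> = A * (2 * (B + 1)) ^ n * c n"
      by (simp only: A_def D_def Suc power_mult_distrib mult_ac)
    also have "\<dots> \<le> max A (\<bar>M\<bar> / c 0) * (2 * (B + 1)) ^ n * c n"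
      using f(3) c(1)[of n] by (intro mult_right_mono) auto
    finally show ?thesis .
  qed
  moreover have "0 < 2 * (B + 1)" using f(3) by simp
  ultimately show ?thesis using that[OF K _ _ K_supp q] by blast
qed

section \<open>Compactly supported functions with derivative bounds of rate below one\<close>

text \<open>The requirement \<open>B < 1\<close> makes the squares of the bounds summable over all
  multi-indices, once the factors \<open>c n\<close> are taken out. This later gives norm estimates
  whose constant does not depend on the order of the Sobolev space.\<close>

definition small_seq :: "(nat \<Rightarrow> real) \<Rightarrow> (nat \<Rightarrow> real \<Rightarrow> real) \<Rightarrow> bool" where
  "small_seq c F \<longleftrightarrow> deriv_seq F \<and> (\<exists>R. \<forall>n x. R < \<bar>x\<bar> \<longrightarrow> F n x = 0) \<and>
     (\<exists>B C. 0 < B \<and> B < 1 \<and> (\<forall>n x. \<bar>F n x\<bar> \<le> C * B ^ n * c n))"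

text \<open>Dilation by \<open>1 / (2 * B)\<close> turns the rate \<open>B\<close> into 1/2;
  translation and a sign move a point of nonvanishing to 0 and make the value there
  positive.\<close>

lemma small_seq_exists:
  assumes "\<And>n. 0 < c n" "incseq c" "\<not> quasi_analytic c"
  obtains F where "small_seq c F" "0 < F 0 0"
proof -
  obtain K B C R p where K: "deriv_seq K" "0 < B" "\<And>n x. \<bar>K n x\<bar> \<le> C * B ^ n * c n"
    "\<And>n x. R < \<bar>x\<bar> \<Longrightarrow> K n x = 0" "K 0 p \<noteq> 0"
    using not_quasi_analytic_compact_support[OF assms] by blast
  define a where "a = 1 / (2 * B)"
  have a: "0 < a" "a * B = 1 / 2" using K(2) by (auto simp: a_def)
  define F where "F n x = sgn (K 0 p) * (a ^ n * K n (a * x + p))" for n x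
  have 1: "deriv_seq F"
    using deriv_seq_lincomb[OF deriv_seq_affine[OF K(1)] deriv_seq_affine[OF K(1)], of "sgn (K 0 p)" a p 0]
    by (simp add: F_def[abs_def])
  have 2: "F n x = 0" if "(R + \<bar>p\<bar>) / a < \<bar>x\<bar>" for n x
  proof -
    have "R + \<bar>p\<bar> < \<bar>a * x\<bar>"
      using that a(1) by (simp add: pos_divide_less_eq abs_mult mult.commute)
    then have "R < \<bar>a * x + p\<bar>" by linarith
    then show ?thesis by (simp add: F_def K(4))
  qed
  have 3: "\<bar>F n x\<bar> \<le> C * (1 / 2) ^ n * c n" for n x
  proof -
    have "\<bar>F n x\<bar> = a ^ n * \<bar>K n (a * x + p)\<bar>"
      using K(5) a(1) by (simp add: F_def abs_mult power_abs abs_sgn_eq)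
    also have "\<dots> \<le> a ^ n * (C * B ^ n * c n)"
      using a(1) by (intro mult_left_mono K(3)) simp
    also have "\<dots> = C * (a * B) ^ n * c n" by (simp add: power_mult_distrib mult_ac)
    finally show ?thesis by (simp only: a(2))
  qed
  have "small_seq c F"
    unfolding small_seq_def using 1 2 3
    by (intro conjI exI[of _ "1 / 2"] exI[of _ "(R + \<bar>p\<bar>) / a"] exI[of _ C]) simp_all
  moreover have "0 < F 0 0"
    using K(5) by (simp add: F_def mult.commute[of "sgn _"] flip: abs_sgn)
  ultimately show ?thesis by (rule that)
qed

lemma small_seq_lincomb:
  assumes c: "\<And>n. 0 < c n" and "small_seq c F" "small_seq c G"
  shows "small_seq c (\<lambda>n x. a * F n x + b * G n x)"
proof -
  obtain R B C where F: "deriv_seq F" "\<And>n x. R < \<bar>x\<bar> \<Longrightarrow> F n x = 0" "0 < B" "B < 1"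
    "\<And>n x. \<bar>F n x\<bar> \<le> C * B ^ n * c n"
    using assms(2) unfolding small_seq_def by blast
  obtain R' B' C' where G: "deriv_seq G" "\<And>n x. R' < \<bar>x\<bar> \<Longrightarrow> G n x = 0" "0 < B'" "B' < 1"
    "\<And>n x. \<bar>G n x\<bar> \<le> C' * B' ^ n * c n"
    using assms(3) unfolding small_seq_def by blast
  define D where "D = max B B'"
  have "\<bar>a * F n x + b * G n x\<bar> \<le> (\<bar>a\<bar> * \<bar>C\<bar> + \<bar>b\<bar> * \<bar>C'\<bar>) * D ^ n * c n" for n x
  proof -
    have "\<bar>F n x\<bar> \<le> \<bar>C\<bar> * D ^ n * c n"
      using F(3) c[of n] by (intro order_trans[OF F(5)] mult_right_mono mult_mono power_mono) (auto simp: D_def)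
    moreover have "\<bar>G n x\<bar> \<le> \<bar>C'\<bar> * D ^ n * c n"
      using G(3) c[of n] by (intro order_trans[OF G(5)] mult_right_mono mult_mono power_mono) (auto simp: D_def)
    ultimately have "\<bar>a\<bar> * \<bar>F n x\<bar> + \<bar>b\<bar> * \<bar>G n x\<bar> \<le> \<bar>a\<bar> * (\<bar>C\<bar> * D ^ n * c n) + \<bar>b\<bar> * (\<bar>C'\<bar> * D ^ n * c n)"
      by (intro add_mono mult_left_mono) auto
    then have "\<bar>a\<bar> * \<bar>F n x\<bar> + \<bar>b\<bar> * \<bar>G n x\<bar> \<le> (\<bar>a\<bar> * \<bar>C\<bar> + \<bar>b\<bar> * \<bar>C'\<bar>) * D ^ n * c n"
      by (simp add: algebra_simps)
    then show ?thesis
      using abs_triangle_ineq[of "a * F n x" "b * G n x"] by (simp add: abs_mult)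
  qed
  moreover have "0 < D" "D < 1" using F G by (auto simp: D_def)
  moreover have "a * F n x + b * G n x = 0" if "max R R' < \<bar>x\<bar>" for n x
    using that F(2) G(2) by simp
  ultimately show ?thesis
    unfolding small_seq_def using deriv_seq_lincomb[OF F(1) G(1)]
    by (intro conjI exI[of _ "max R R'"] exI[of _ D] exI[of _ "\<bar>a\<bar> * \<bar>C\<bar> + \<bar>b\<bar> * \<bar>C'\<bar>"]) auto
qed

text \<open>The support is bounded, which controls the factor \<open>x\<close>. The factor
  \<open>n\<close> from Leibniz's formula is absorbed by raising the rate from \<open>B\<close> to
  the midpoint \<open>D\<close> of \<open>B\<close> and 1, as \<open>real n * (B / D) ^ n\<close> is
  bounded. Monotonicity replaces \<open>c (n - 1)\<close> by \<open>c n\<close>.\<close>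

lemma small_seq_times_id:
  assumes c: "\<And>n. 0 < c n" "incseq c" and "small_seq c F"
  shows "small_seq c (\<lambda>n x. x * F n x + real n * F (n - 1) x)"
proof -
  obtain R B C where F: "deriv_seq F" "\<And>n x. R < \<bar>x\<bar> \<Longrightarrow> F n x = 0" "0 < B" "B < 1"
    "\<And>n x. \<bar>F n x\<bar> \<le> C * B ^ n * c n"
    using assms(3) unfolding small_seq_def by blast
  define D where "D = (1 + B) / 2"
  have D: "B < D" "0 < D" "D < 1" using F(3,4) by (auto simp: D_def)
  have "(\<lambda>n. real n * (B / D) ^ n) \<longlonglongrightarrow> 0"
    by (rule powser_times_n_limit_0) (use D F(3) in auto)
  from convergent_imp_Bseq[OF convergentI[OF this]]
  obtain L where L: "\<And>n. norm (real n * (B / D) ^ n) \<le> L" by (rule BseqE) blast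
  have nB: "real n * B ^ n \<le> L * D ^ n" for n
  proof -
    have "real n * (B / D) ^ n \<le> L"
      using L[of n] D F(3) by (simp add: abs_mult power_abs)
    then show ?thesis using D by (simp add: power_divide field_simps)
  qed
  have "\<bar>x * F n x + real n * F (n - 1) x\<bar> \<le> (\<bar>R\<bar> * \<bar>C\<bar> + \<bar>C\<bar> * L / B) * D ^ n * c n" for n x
  proof -
    have 1: "\<bar>x * F n x\<bar> \<le> \<bar>R\<bar> * (\<bar>C\<bar> * D ^ n * c n)"
    proof (cases "R < \<bar>x\<bar>")
      case True
      then show ?thesis using F(2) D c(1)[of n] by simp
    next
      case False
      have "\<bar>F n x\<bar> \<le> \<bar>C\<bar> * D ^ n * c n"
        using F(3) c(1)[of n] D by (intro order_trans[OF F(5)] mult_right_mono mult_mono power_mono) auto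
      then show ?thesis unfolding abs_mult using False by (intro mult_mono) auto
    qed
    have 2: "\<bar>real n * F (n - 1) x\<bar> \<le> \<bar>C\<bar> * L / B * D ^ n * c n"
    proof (cases n)
      case (Suc m)
      have "\<bar>F m x\<bar> \<le> \<bar>C\<bar> * B ^ m * c n"
        using F(3) c(1)[of m] D incseqD[OF c(2), of m n] Suc
        by (intro order_trans[OF F(5)] mult_mono) auto
      then have "\<bar>real n * F (n - 1) x\<bar> \<le> real n * (\<bar>C\<bar> * B ^ m * c n)"
        unfolding abs_mult by (intro mult_mono) (auto simp: Suc)
      also have "\<dots> = (\<bar>C\<bar> / B * c n) * (real n * B ^ n)"
        using F(3) by (simp add: Suc)
      also have "\<dots> \<le> (\<bar>C\<bar> / B * c n) * (L * D ^ n)"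
        using F(3) c(1)[of n] by (intro mult_left_mono nB) auto
      finally show ?thesis by (simp add: mult_ac)
    qed (use L[of 0] F(3) D c(1)[of 0] in auto)
    show ?thesis
      using order_trans[OF abs_triangle_ineq add_mono[OF 1 2]] by (simp add: algebra_simps)
  qed
  then show ?thesis
    unfolding small_seq_def using deriv_seq_times_id[OF F(1)] D F(2)
    by (intro conjI exI[of _ R] exI[of _ D] exI[of _ "\<bar>R\<bar> * \<bar>C\<bar> + \<bar>C\<bar> * L / B"]) simp_all
qed

lemma small_seq_times_parabola_power:
  assumes c: "\<And>n. 0 < c n" "incseq c" and F: "small_seq c F"
  obtains G where "small_seq c G" "G 0 = (\<lambda>x. (1 - (x / r)\<^sup>2) ^ m * F 0 x)"
proof -
  have "\<exists>G. small_seq c G \<and> G 0 = (\<lambda>x. (1 - (x / r)\<^sup>2) ^ m * F 0 x)"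
  proof (induction m)
    case (Suc m)
    then obtain G where G: "small_seq c G" "G 0 = (\<lambda>x. (1 - (x / r)\<^sup>2) ^ m * F 0 x)" by auto
    show ?case
    proof (intro exI conjI)
      \<comment> \<open>The nested expression is the derivative sequence of
        \<open>x\<^sup>2 * G 0 x\<close>, that is, multiplication by \<open>x\<close> applied
        twice.\<close>
      show "small_seq c (\<lambda>n x. 1 * G n x + - (1 / r\<^sup>2) *
          (x * (x * G n x + real n * G (n - 1) x) + real n * (x * G (n - 1) x + real (n - 1) * G (n - 1 - 1) x)))"
        by (intro small_seq_lincomb small_seq_times_id c G)
    qed (simp add: G(2) fun_eq_iff power2_eq_square algebra_simps)
  qed (use F in \<open>auto intro: exI[of _ F]\<close>)
  with that show ?thesis by blast
qed

section \<open>Smooth functions and products of functions of one variable\<close>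

lemma smoothD: "smooth f \<Longrightarrow> foldr partial js f differentiable at x"
  by (auto simp: smooth_def differentiable_on_def)

lemma smooth_foldr_partial: "smooth f \<Longrightarrow> smooth (foldr partial js f)"
  by (simp add: smooth_def flip: foldr_append)

lemma smooth_continuous_on: "smooth f \<Longrightarrow> continuous_on A (foldr partial js f)"
  by (meson continuous_on_subset differentiable_imp_continuous_on smooth_def subset_UNIV)

text \<open>\<open>partial\<close> only speaks of the derivative at parameter 0; moving the base
  point along the line gives it at every \<open>t\<close>.\<close>

lemma partial_DERIV:
  fixes f :: "real^'d::finite \<Rightarrow> real"
  assumes "\<And>x. f differentiable at x"
  shows "((\<lambda>t. f (x + t *\<^sub>R axis i 1)) has_real_derivative partial i f (x + t *\<^sub>R axis i 1)) (at t)"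
proof -
  have "((\<lambda>s. f (y + s *\<^sub>R axis i 1)) has_real_derivative partial i f y) (at 0)" for y
  proof -
    have "(\<lambda>s. f (y + s *\<^sub>R axis i 1)) differentiable at 0"
      using differentiable_compose[of f "\<lambda>s. y + s *\<^sub>R axis i 1" 0 UNIV] assms by simp
    then show ?thesis
      by (simp add: partial_def DERIV_deriv_iff_real_differentiable)
  qed
  from this[of "x + t *\<^sub>R axis i 1"] show ?thesis
    using DERIV_shift[of "\<lambda>t. f (x + t *\<^sub>R axis i 1)" _ 0 t] by (simp add: algebra_simps)
qed

lemma foldr_partial_DERIV:
  assumes "smooth f"
  shows "((\<lambda>t. foldr partial js f (x + t *\<^sub>R axis i 1)) has_real_derivative
    foldr partial (i # js) f (x + t *\<^sub>R axis i 1)) (at t)"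
  using partial_DERIV[of "foldr partial js f"] smoothD[OF assms] by simp

lemma partial_eqI:
  "((\<lambda>t. f (x + t *\<^sub>R axis i 1)) has_real_derivative D) (at 0) \<Longrightarrow> partial i f x = D"
  by (simp add: partial_def DERIV_imp_deriv)

lemma foldr_partial_sum:
  assumes "\<And>a. a \<in> I \<Longrightarrow> smooth (f a)"
  shows "foldr partial js (\<lambda>x. \<Sum>a\<in>I. w a * f a x) = (\<lambda>x. \<Sum>a\<in>I. w a * foldr partial js (f a) x)"
proof (induction js)
  case (Cons i js)
  show ?case
    unfolding foldr.simps o_apply Cons
    by (intro ext partial_eqI DERIV_sum DERIV_cmult)
      (use foldr_partial_DERIV[OF assms, of _ js _ i 0] in simp)
qed simp

lemma smooth_sum:
  assumes "finite I" "\<And>a. a \<in> I \<Longrightarrow> smooth (f a)"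
  shows "smooth (\<lambda>x. \<Sum>a\<in>I. w a * f a x)"
  unfolding smooth_def differentiable_on_def
proof (intro allI ballI)
  fix js x
  show "foldr partial js (\<lambda>x. \<Sum>a\<in>I. w a * f a x) differentiable at x"
    by (subst foldr_partial_sum[OF assms(2)])
      (auto intro!: differentiable_sum assms(1) differentiable_mult smoothD assms(2))
qed

lemma foldr_partial_scale:
  assumes "smooth f"
  shows "foldr partial js (\<lambda>x. a * f x) = (\<lambda>x. a * foldr partial js f x)"
  using foldr_partial_sum[of "{()}" "\<lambda>_. f" js "\<lambda>_. a"] assms by simp

lemma smooth_scale: "smooth f \<Longrightarrow> smooth (\<lambda>x. a * f x)"
  using smooth_sum[of "{()}" "\<lambda>_. f" "\<lambda>_. a"] by simp

lemma foldr_partial_diff: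
  assumes "smooth f" "smooth g"
  shows "foldr partial js (\<lambda>x. f x - g x) = (\<lambda>x. foldr partial js f x - foldr partial js g x)"
  using foldr_partial_sum[of UNIV "\<lambda>b. if b then f else g" js "\<lambda>b. if b then 1 else - 1"] assms
  by (simp add: UNIV_bool)

lemma smooth_diff: "smooth f \<Longrightarrow> smooth g \<Longrightarrow> smooth (\<lambda>x. f x - g x)"
  using smooth_sum[of UNIV "\<lambda>b. if b then f else g" "\<lambda>b. if b then 1 else - 1"]
  by (simp add: UNIV_bool)

lemma foldr_partial_zero_outside:
  assumes "smooth f" "closed K" "\<And>x. x \<notin> K \<Longrightarrow> f x = 0" "x \<notin> K"
  shows "foldr partial js f x = 0"
  using assms(4)
proof (induction js arbitrary: x)
  case (Cons i js)
  have "open ((\<lambda>t. x + t *\<^sub>R axis i 1) -` (- K))"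
    by (rule open_vimage) (auto intro!: continuous_intros simp: assms(2) open_Compl)
  then have "((\<lambda>t. foldr partial js f (x + t *\<^sub>R axis i 1)) has_real_derivative 0) (at 0)"
    by (rule has_field_derivative_transform_within_open[where f = "\<lambda>_. 0", OF DERIV_const])
      (use Cons in \<open>auto simp: Cons.IH\<close>)
  then show ?case by (simp add: partial_eqI)
qed (use assms in auto)

lemma test_functions_iff_bounded:
  "f \<in> test_functions \<longleftrightarrow> smooth f \<and> (\<exists>R. \<forall>x. R < norm x \<longrightarrow> f x = 0)"
proof -
  have "bounded {x. f x \<noteq> 0} \<longleftrightarrow> (\<exists>R. \<forall>x. R < norm x \<longrightarrow> f x = 0)"
    unfolding bounded_iff by (auto simp: not_le) (meson not_le)+
  then show ?thesis by (simp add: test_functions_def)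
qed

lemma foldr_partial_zero_outside_ball:
  assumes "smooth f" "\<And>x. R < norm x \<Longrightarrow> f x = 0" "R < norm x"
  shows "foldr partial js f x = 0"
  using foldr_partial_zero_outside[OF assms(1) closed_cball[of 0 R]] assms(2,3) by (auto simp: not_le)

text \<open>For derivative sequences \<open>F i\<close> this is the partial derivative of order
  \<open>\<alpha>\<close> of the product of the functions \<open>F i 0 (x $ i)\<close>.\<close>

definition tens :: "('d::finite \<Rightarrow> nat \<Rightarrow> real \<Rightarrow> real) \<Rightarrow> ('d \<Rightarrow> nat) \<Rightarrow> real^'d \<Rightarrow> real" where
  "tens F \<alpha> x = (\<Prod>i\<in>UNIV. F i (\<alpha> i) (x $ i))"

lemma partial_tens:
  assumes "\<And>i. deriv_seq (F i)"
  shows "partial i (tens F \<alpha>) = tens F (\<alpha>(i := Suc (\<alpha> i)))"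
proof (intro ext partial_eqI)
  fix x
  have "((\<lambda>t. F i (\<alpha> i) (x $ i + t) * (\<Prod>j\<in>UNIV - {i}. F j (\<alpha> j) (x $ j))) has_real_derivative
     F i (Suc (\<alpha> i)) (x $ i + 0) * (\<Prod>j\<in>UNIV - {i}. F j (\<alpha> j) (x $ j))) (at 0)"
    using DERIV_chain2[OF deriv_seqD[OF assms] DERIV_add[OF DERIV_const DERIV_ident], of i "\<alpha> i" "x $ i" 0 UNIV]
    by (intro DERIV_cmult_right) simp
  moreover have "tens F \<alpha> (x + t *\<^sub>R axis i 1) = F i (\<alpha> i) (x $ i + t) * (\<Prod>j\<in>UNIV - {i}. F j (\<alpha> j) (x $ j))" for t
    unfolding tens_def by (subst prod.remove[of _ i]) (auto simp: axis_def intro!: prod.cong)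
  moreover have "tens F (\<alpha>(i := Suc (\<alpha> i))) x = F i (Suc (\<alpha> i)) (x $ i + 0) * (\<Prod>j\<in>UNIV - {i}. F j (\<alpha> j) (x $ j))"
    unfolding tens_def by (subst prod.remove[of _ i]) (auto intro!: prod.cong)
  ultimately show "((\<lambda>t. tens F \<alpha> (x + t *\<^sub>R axis i 1)) has_real_derivative tens F (\<alpha>(i := Suc (\<alpha> i))) x) (at 0)"
    by simp
qed

lemma foldr_partial_tens:
  assumes "\<And>i. deriv_seq (F i)"
  shows "foldr partial js (tens F \<alpha>) = tens F (\<lambda>i. \<alpha> i + count_list js i)"
proof (induction js)
  case (Cons i js)
  have "(\<lambda>j. \<alpha> j + count_list js j)(i := Suc (\<alpha> i + count_list js i)) = (\<lambda>j. \<alpha> j + count_list (i # js) j)"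
    by auto
  then show ?case by (simp add: Cons partial_tens[OF assms])
qed simp

text \<open>Partial derivatives alone do not give the Frechet differentiability asked for in
  \<open>smooth\<close>; the product rule for factors composed with coordinate projections
  does.\<close>

lemma tens_differentiable:
  assumes "\<And>i. deriv_seq (F i)"
  shows "tens F \<alpha> differentiable at x"
proof -
  have "(\<lambda>x. F i (\<alpha> i) (x $ i)) differentiable at x" for i
  proof -
    have "F i (\<alpha> i) differentiable at (x $ i)"
      using deriv_seqD[OF assms] real_differentiable_def by blast
    then show ?thesis
      by (rule differentiable_compose) (simp add: bounded_linear_imp_differentiable bounded_linear_vec_nth)
  qed
  then obtain D where D: "\<And>i. ((\<lambda>x. F i (\<alpha> i) (x $ i)) has_derivative D i) (at x)"
    unfolding differentiable_def by metis
  show ?thesis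
    unfolding differentiable_def tens_def[abs_def]
    by (rule exI, rule has_derivative_prod) (rule D)
qed

lemma smooth_tens: "(\<And>i. deriv_seq (F i)) \<Longrightarrow> smooth (tens F \<alpha>)"
  by (simp add: smooth_def differentiable_on_def foldr_partial_tens tens_differentiable)

text \<open>Spells a multi-index as one word of coordinates, so that facts about arbitrary words of
  partial derivatives apply to \<open>D_multi\<close>.\<close>

definition dlist :: "('d::finite \<Rightarrow> nat) \<Rightarrow> 'd list" where
  "dlist \<beta> = concat (map (\<lambda>j. replicate (\<beta> j) j) coords)"

lemma D_multi_eq: "D_multi \<beta> f = foldr partial (dlist \<beta>) f"
proof -
  have *: "foldr partial (concat (map (\<lambda>j. replicate (\<beta> j) j) js)) f = foldr (\<lambda>j. partial j ^^ \<beta> j) js f" for js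
    by (induction js) (simp_all add: foldr_replicate)
  show ?thesis by (simp add: multi_deriv_def dlist_def *)
qed

lemma coords: "distinct (coords :: 'd::finite list)" "set (coords :: 'd list) = UNIV"
proof -
  have "\<exists>js::'d list. distinct js \<and> set js = UNIV"
    using finite_distinct_list[OF finite[of UNIV]] by auto
  from someI_ex[OF this] show "distinct (coords :: 'd::finite list)" "set (coords :: 'd list) = UNIV"
    by (auto simp: coords_def)
qed

lemma count_dlist: "count_list (dlist \<beta>) i = \<beta> i"
proof -
  have rep: "count_list (replicate n j) i = (if j = i then n else 0)" for n and j :: 'a
    by (induction n) auto
  have "distinct js \<Longrightarrow> count_list (concat (map (\<lambda>j. replicate (\<beta> j) j) js)) i = (if i \<in> set js then \<beta> i else 0)" for js
    by (induction js) (auto simp: rep)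
  from this[OF coords(1)] show ?thesis by (simp add: dlist_def coords(2))
qed

lemma D_multi_tens: "(\<And>i. deriv_seq (F i)) \<Longrightarrow> D_multi \<beta> (tens F (\<lambda>_. 0)) = tens F \<beta>"
  by (simp add: D_multi_eq foldr_partial_tens count_dlist)

lemma multi_index_le: "\<beta> i \<le> sum \<beta> UNIV" for \<beta> :: "'d::finite \<Rightarrow> nat"
  by (rule member_le_sum) auto

lemma multi_indices_subset: "{\<beta> :: 'd::finite \<Rightarrow> nat. sum \<beta> UNIV \<le> n} \<subseteq> PiE UNIV (\<lambda>_. {..n})"
  using multi_index_le order_trans by fastforce

section \<open>Estimates of the weighted Sobolev norms\<close>

lemma H_norm_scale:
  assumes "smooth f"
  shows "H_norm k (\<lambda>x. a * f x) = \<bar>a\<bar> * H_norm k f"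
proof -
  have "(\<integral>x. \<bar>D_multi \<beta> (\<lambda>x. a * f x) x\<bar>\<^sup>2 * snd k x \<partial>lborel) = a\<^sup>2 * (\<integral>x. \<bar>D_multi \<beta> f x\<bar>\<^sup>2 * snd k x \<partial>lborel)" for \<beta>
    by (simp add: D_multi_eq foldr_partial_scale[OF assms] power_mult_distrib mult.assoc)
  then show ?thesis
    by (simp add: H_norm_def sum_distrib_left[symmetric] real_sqrt_mult)
qed

lemma weight_continuous_on: "k \<in> weight_index \<Longrightarrow> continuous_on A (snd k)"
  using smooth_continuous_on[of "snd k" A "[]"] by (auto simp: weight_index_def)

lemma H_norm_le:
  fixes f :: "real^'d::finite \<Rightarrow> real"
  assumes f: "smooth f" "\<And>x. R < norm x \<Longrightarrow> f x = 0"
    and k: "k \<in> weight_index" and S: "\<And>x. norm x \<le> R \<Longrightarrow> snd k x \<le> S" "0 \<le> S"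
    and M: "\<And>\<beta> x. sum \<beta> UNIV \<le> fst k \<Longrightarrow> \<bar>D_multi \<beta> f x\<bar> \<le> M \<beta>"
  shows "H_norm k f \<le> sqrt (S * measure lborel (cball 0 R :: (real^'d) set) * (\<Sum>\<beta> | sum \<beta> UNIV \<le> fst k. (M \<beta>)\<^sup>2))"
proof -
  have "(\<integral>x. \<bar>D_multi \<beta> f x\<bar>\<^sup>2 * snd k x \<partial>lborel) \<le> S * measure lborel (cball 0 R :: (real^'d) set) * (M \<beta>)\<^sup>2"
    if \<beta>: "sum \<beta> UNIV \<le> fst k" for \<beta>
  proof -
    have "(\<integral>x. \<bar>D_multi \<beta> f x\<bar>\<^sup>2 * snd k x \<partial>lborel)
        \<le> (\<integral>x. ((M \<beta>)\<^sup>2 * S) * indicator (cball 0 R :: (real^'d) set) x \<partial>lborel)"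
    \<comment> \<open>This rule asks for integrability of the majorant only.\<close>
    proof (rule integral_mono')
      show "integrable lborel (\<lambda>x::real^'d. ((M \<beta>)\<^sup>2 * S) * indicator (cball 0 R) x)"
        using emeasure_lborel_cball_finite[of "0 :: real^'d" R]
        by (intro integrable_mult_right integrable_real_indicator) auto
      fix x :: "real^'d"
      show "0 \<le> ((M \<beta>)\<^sup>2 * S) * indicator (cball 0 R) x" using S(2) by simp
      show "\<bar>D_multi \<beta> f x\<bar>\<^sup>2 * snd k x \<le> ((M \<beta>)\<^sup>2 * S) * indicator (cball 0 R) x"
      proof (cases "norm x \<le> R")
        case True
        have "0 \<le> snd k x" using k by (auto simp: weight_index_def intro: order_trans[OF zero_le_one])
        then have "\<bar>D_multi \<beta> f x\<bar>\<^sup>2 * snd k x \<le> (M \<beta>)\<^sup>2 * S"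
          by (intro mult_mono power_mono M[OF \<beta>] S(1) True) auto
        then show ?thesis using True by simp
      next
        case False
        then show ?thesis
          using foldr_partial_zero_outside_ball[OF f] by (simp add: D_multi_eq)
      qed
    qed
    also have "\<dots> = S * measure lborel (cball 0 R :: (real^'d) set) * (M \<beta>)\<^sup>2" by simp
    finally show ?thesis .
  qed
  then have "(\<Sum>\<beta> | sum \<beta> UNIV \<le> fst k. \<integral>x. \<bar>D_multi \<beta> f x\<bar>\<^sup>2 * snd k x \<partial>lborel)
      \<le> (\<Sum>\<beta> | sum \<beta> UNIV \<le> fst k. S * measure lborel (cball 0 R :: (real^'d) set) * (M \<beta>)\<^sup>2)"
    by (intro sum_mono) auto
  then show ?thesis
    unfolding H_norm_def sum_distrib_left[symmetric] by simp
qed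

definition weight_sup :: "(real^'d::finite \<Rightarrow> real) \<Rightarrow> real \<Rightarrow> real" where
  "weight_sup k2 r = (SUP z \<in> cball 0 r. SUP x \<in> {x. \<forall>i. x $ i \<in> {-1..1}}. sqrt (k2 (z + x)))"

text \<open>The cube contains 0, so the value at \<open>y\<close> is among those over which the
  suprema run. What has to be shown is that both suprema are over bounded sets; this holds because
  all points \<open>z + x\<close> stay in a compact ball.\<close>

lemma weight_le_weight_sup:
  fixes k :: "nat \<times> (real^'d::finite \<Rightarrow> real)"
  assumes k: "k \<in> weight_index" and y: "norm y \<le> r"
  shows "sqrt (snd k y) \<le> weight_sup (snd k) r"
proof -
  define Q where "Q = {x::real^'d. \<forall>i. x $ i \<in> {-1..1}}"
  \<comment> \<open>On the cube the norm is at most the sum of the absolute coordinates, hence at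
    most the dimension.\<close>
  define T where "T = (cball 0 (r + real CARD('d)) :: (real^'d) set)"
  have Q0: "0 \<in> Q" by (simp add: Q_def)
  have QT: "z + x \<in> T" if "z \<in> cball 0 r" "x \<in> Q" for z x
  proof -
    have "norm x \<le> (\<Sum>i\<in>UNIV. \<bar>x $ i\<bar>)" by (rule norm_le_l1_cart)
    also have "\<dots> \<le> (\<Sum>i\<in>(UNIV::'d set). 1)" using that(2) by (intro sum_mono) (auto simp: Q_def abs_le_iff minus_le_iff)
    finally show ?thesis using that(1) norm_triangle_ineq[of z x] by (simp add: T_def)
  qed
  have "bounded (snd k ` T)"
    unfolding T_def by (intro compact_imp_bounded compact_continuous_image weight_continuous_on k compact_cball)
  then obtain M where "\<And>x. x \<in> T \<Longrightarrow> \<bar>snd k x\<bar> \<le> M"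
    unfolding bounded_iff by (metis imageI real_norm_def)
  then have M: "sqrt (snd k (z + x)) \<le> sqrt M" if "z \<in> cball 0 r" "x \<in> Q" for z x
    using QT[OF that] by (intro real_sqrt_le_mono) (meson abs_ge_self order_trans)
  have 1: "sqrt (snd k z) \<le> (SUP x \<in> Q. sqrt (snd k (z + x)))" if "z \<in> cball 0 r" for z
    using cSUP_upper[OF Q0 bdd_aboveI2[of Q "\<lambda>x. sqrt (snd k (z + x))", OF M[OF that]]] by simp
  have 2: "(SUP x \<in> Q. sqrt (snd k (z + x))) \<le> sqrt M" if "z \<in> cball 0 r" for z
    using M[OF that] Q0 by (intro cSUP_least) auto
  have "(SUP x \<in> Q. sqrt (snd k (y + x))) \<le> (SUP z \<in> cball 0 r. SUP x \<in> Q. sqrt (snd k (z + x)))"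
    using y 2 by (intro cSUP_upper bdd_aboveI2[where M = "sqrt M"]) auto
  with 1[of y] y show ?thesis by (simp add: weight_sup_def Q_def)
qed

lemma small_seq_translate: "deriv_seq F \<Longrightarrow> deriv_seq (\<lambda>n x. F n (x - a))"
  using deriv_seq_affine[of F 1 "- a"] by simp

abbreviation translated :: "(nat \<Rightarrow> real \<Rightarrow> real) \<Rightarrow> real^'d::finite \<Rightarrow> 'd \<Rightarrow> nat \<Rightarrow> real \<Rightarrow> real" where
  "translated F y \<equiv> \<lambda>i n x. F n (x - y $ i)"

text \<open>If all coordinates of \<open>x - y\<close> were at most \<open>R\<close> in absolute
  value, those of \<open>x\<close> would be at most \<open>R + Y\<close>, and summing them would
  contradict the size of \<open>norm x\<close>.\<close>

lemma tens_translated_zero_outside: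
  fixes x y :: "real^'d::finite"
  assumes "\<And>i x. R < \<bar>x\<bar> \<Longrightarrow> F (\<alpha> i) x = 0" "norm y \<le> Y" "real CARD('d) * (R + Y) < norm x"
  shows "tens (translated F y) \<alpha> x = 0"
proof -
  have "\<exists>i. R < \<bar>x $ i - y $ i\<bar>"
  proof (rule ccontr)
    assume none: "\<not> ?thesis"
    have le: "\<bar>x $ i\<bar> \<le> R + Y" for i
    proof -
      have "\<bar>x $ i - y $ i\<bar> \<le> R" using none by (auto simp: not_less)
      then show ?thesis using component_le_norm_cart[of y i] assms(2) by linarith
    qed
    have "norm x \<le> (\<Sum>i\<in>UNIV. \<bar>x $ i\<bar>)" by (rule norm_le_l1_cart)
    also have "\<dots> \<le> (\<Sum>i\<in>(UNIV::'d set). R + Y)" by (intro sum_mono le)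
    finally show False using assms(3) by simp
  qed
  then show ?thesis unfolding tens_def using assms(1) by (intro prod_zero) auto
qed

lemma tens_translated_test_function:
  fixes y :: "real^'d::finite"
  assumes "small_seq c F"
  shows "tens (translated F y) \<alpha> \<in> test_functions"
proof -
  obtain R where R: "\<And>n x. R < \<bar>x\<bar> \<Longrightarrow> F n x = 0" and F: "deriv_seq F"
    using assms unfolding small_seq_def by blast
  have "\<forall>x. real CARD('d) * (R + norm y) < norm x \<longrightarrow> tens (translated F y) \<alpha> x = 0"
    using tens_translated_zero_outside[where F = F and R = R, OF R order_refl] by auto
  then show ?thesis
    unfolding test_functions_iff_bounded using smooth_tens[OF small_seq_translate[OF F]] by blast
qed

lemma weight_sup_ge_1:
  assumes "k \<in> weight_index" "0 \<le> r"
  shows "1 \<le> weight_sup (snd k) r"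
proof -
  have "1 \<le> sqrt (snd k 0)" using assms by (auto simp: weight_index_def)
  also have "\<dots> \<le> weight_sup (snd k) r" by (rule weight_le_weight_sup) (use assms in auto)
  finally show ?thesis .
qed

text \<open>Enlarging the set of multi-indices to a cube factors the sum into geometric sums, one
  for each coordinate; the bound is independent of \<open>n\<close>.\<close>

lemma sum_multi_index_geometric:
  fixes B :: real
  assumes "0 \<le> B" "B < 1"
  shows "(\<Sum>\<beta> :: 'd::finite \<Rightarrow> nat | sum \<beta> UNIV \<le> n. (\<Prod>i\<in>UNIV. B ^ \<beta> i)\<^sup>2) \<le> (1 / (1 - B\<^sup>2)) ^ CARD('d)"
proof -
  have B2: "0 \<le> B\<^sup>2" "B\<^sup>2 < 1" using assms by (auto simp: power2_eq_square mult_strict_mono[of B 1 B 1, simplified])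
  have "(\<Sum>\<beta> :: 'd \<Rightarrow> nat | sum \<beta> UNIV \<le> n. (\<Prod>i\<in>UNIV. B ^ \<beta> i)\<^sup>2)
      \<le> (\<Sum>\<beta> \<in> PiE (UNIV :: 'd set) (\<lambda>_. {..n}). (\<Prod>i\<in>UNIV. B ^ \<beta> i)\<^sup>2)"
    by (rule sum_mono2[OF _ multi_indices_subset]) (auto simp: finite_PiE)
  also have "\<dots> = (\<Sum>\<beta> \<in> PiE (UNIV :: 'd set) (\<lambda>_. {..n}). \<Prod>i\<in>UNIV. (B\<^sup>2) ^ \<beta> i)"
    by (simp add: prod_power_distrib power_mult[symmetric] mult.commute)
  also have "\<dots> = (\<Prod>i\<in>(UNIV :: 'd set). \<Sum>j\<le>n. (B\<^sup>2) ^ j)"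
    by (subst prod_sum_PiE) auto
  also have "\<dots> \<le> (\<Prod>i\<in>(UNIV :: 'd set). 1 / (1 - B\<^sup>2))"
  proof (rule prod_mono)
    have "(\<Sum>j\<le>n. (B\<^sup>2) ^ j) \<le> (\<Sum>j. (B\<^sup>2) ^ j)"
      using B2 by (intro sum_le_suminf summable_geometric) auto
    also have "\<dots> = 1 / (1 - B\<^sup>2)" using B2 by (intro suminf_geometric) auto
    finally show "0 \<le> (\<Sum>j\<le>n. (B\<^sup>2) ^ j) \<and> (\<Sum>j\<le>n. (B\<^sup>2) ^ j) \<le> 1 / (1 - B\<^sup>2)" for i :: 'd
      by (simp add: sum_nonneg)
  qed
  finally show ?thesis by simp
qed

text \<open>Each coordinate contributes one factor \<open>c (\<beta> i) \<le> c (fst (k n))\<close>,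
  which accounts for the power \<open>CARD('d)\<close>. The remaining geometric factors are summed
  by \<open>sum_multi_index_geometric\<close>, so a single \<open>L\<close> serves all
  orders.\<close>

lemma tens_translated_H_norm_bound:
  fixes k :: "nat \<Rightarrow> nat \<times> (real^'d::finite \<Rightarrow> real)"
  assumes c: "\<And>n. 0 < c n" "incseq c" and k: "\<And>n. k n \<in> weight_index" and F: "small_seq c F"
  obtains L where "0 < L" "\<And>n. H_norm (k n) (tens (translated F y) (\<lambda>_. 0))
      \<le> L * (c (fst (k n)) ^ CARD('d) * weight_sup (snd (k n)) (real n))"
proof -
  obtain R B C where R: "\<And>n x. R < \<bar>x\<bar> \<Longrightarrow> F n x = 0" and ds: "deriv_seq F" and B: "0 < B" "B < 1"
    and C: "\<And>n x. \<bar>F n x\<bar> \<le> C * B ^ n * c n"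
    using F unfolding small_seq_def by blast
  define f where "f = tens (translated F y) (\<lambda>_. 0)"
  define \<rho> where "\<rho> = real CARD('d) * (R + norm y)"
  have f0: "f x = 0" if "\<rho> < norm x" for x
    unfolding f_def by (rule tens_translated_zero_outside[OF R order_refl]) (use that in \<open>simp_all add: \<rho>_def\<close>)
  have sm: "smooth f" unfolding f_def by (intro smooth_tens small_seq_translate ds)
  define rhs where "rhs n = c (fst (k n)) ^ CARD('d) * weight_sup (snd (k n)) (real n)" for n
  have rhs: "0 < rhs n" for n
    using c(1) weight_sup_ge_1[OF k, of "real n" n] by (simp add: rhs_def zero_less_mult_iff)
  define V where "V = measure lborel (cball 0 \<rho> :: (real^'d) set)"
  define A where "A = sqrt (V * ((\<bar>C\<bar> ^ CARD('d))\<^sup>2 * (1 / (1 - B\<^sup>2)) ^ CARD('d)))"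
  \<comment> \<open>For these \<open>n\<close> the support lies in the ball over which
    \<open>weight_sup\<close> is taken.\<close>
  have main: "H_norm (k n) f \<le> A * rhs n" if n: "\<rho> \<le> real n" for n
  proof -
    define M where "M \<beta> = \<bar>C\<bar> ^ CARD('d) * c (fst (k n)) ^ CARD('d) * (\<Prod>i\<in>UNIV. B ^ \<beta> i)" for \<beta> :: "'d \<Rightarrow> nat"
    define S where "S = (weight_sup (snd (k n)) (real n))\<^sup>2"
    have "H_norm (k n) f \<le> sqrt (S * V * (\<Sum>\<beta> | sum \<beta> UNIV \<le> fst (k n). (M \<beta>)\<^sup>2))"
      unfolding V_def
    proof (rule H_norm_le[OF sm f0 k])
      fix x :: "real^'d" assume "norm x \<le> \<rho>"
      then have "sqrt (snd (k n) x) \<le> weight_sup (snd (k n)) (real n)"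
        using n by (intro weight_le_weight_sup k) auto
      then show "snd (k n) x \<le> S"
        unfolding S_def using sqrt_le_D by blast
    next
      fix \<beta> :: "'d \<Rightarrow> nat" and x assume \<beta>: "sum \<beta> UNIV \<le> fst (k n)"
      have "\<bar>D_multi \<beta> f x\<bar> = (\<Prod>i\<in>UNIV. \<bar>F (\<beta> i) (x $ i - y $ i)\<bar>)"
        unfolding f_def by (subst D_multi_tens[OF small_seq_translate[OF ds]]) (simp add: tens_def abs_prod)
      also have "\<dots> \<le> (\<Prod>i\<in>UNIV. \<bar>C\<bar> * c (fst (k n)) * B ^ \<beta> i)"
      proof (intro prod_mono conjI)
        fix i
        have "\<beta> i \<le> fst (k n)" using \<beta> multi_index_le[of \<beta> i] by simp
        then have "C * B ^ \<beta> i * c (\<beta> i) \<le> \<bar>C\<bar> * B ^ \<beta> i * c (fst (k n))"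
          using B c(1)[of "\<beta> i"] incseqD[OF c(2)] by (intro mult_mono) auto
        then show "\<bar>F (\<beta> i) (x $ i - y $ i)\<bar> \<le> \<bar>C\<bar> * c (fst (k n)) * B ^ \<beta> i"
          using C[of "\<beta> i" "x $ i - y $ i"] by (simp add: mult_ac)
      qed simp
      also have "\<dots> = M \<beta>" by (simp add: M_def prod.distrib power_mult_distrib)
      finally show "\<bar>D_multi \<beta> f x\<bar> \<le> M \<beta>" .
    qed (simp_all add: S_def)
    also have "(\<Sum>\<beta> | sum \<beta> UNIV \<le> fst (k n). (M \<beta>)\<^sup>2)
       = (\<bar>C\<bar> ^ CARD('d) * c (fst (k n)) ^ CARD('d))\<^sup>2 * (\<Sum>\<beta> :: 'd \<Rightarrow> nat | sum \<beta> UNIV \<le> fst (k n). (\<Prod>i\<in>UNIV. B ^ \<beta> i)\<^sup>2)"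
      by (simp add: M_def power_mult_distrib sum_distrib_left)
    also have "sqrt (S * V * \<dots>) \<le> sqrt (S * V * ((\<bar>C\<bar> ^ CARD('d) * c (fst (k n)) ^ CARD('d))\<^sup>2 * (1 / (1 - B\<^sup>2)) ^ CARD('d)))"
      using B by (intro real_sqrt_le_mono mult_left_mono sum_multi_index_geometric) (auto simp: S_def V_def)
    also have "\<dots> = A * rhs n"
    proof -
      have "S * V * ((\<bar>C\<bar> ^ CARD('d) * c (fst (k n)) ^ CARD('d))\<^sup>2 * (1 / (1 - B\<^sup>2)) ^ CARD('d))
          = (V * ((\<bar>C\<bar> ^ CARD('d))\<^sup>2 * (1 / (1 - B\<^sup>2)) ^ CARD('d))) * (rhs n)\<^sup>2"
        by (simp add: rhs_def S_def power_mult_distrib mult_ac)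
      then show ?thesis using rhs[of n] by (simp only: A_def real_sqrt_mult real_sqrt_abs abs_of_pos)
    qed
    finally show ?thesis .
  qed
  define N where "N = nat \<lceil>\<rho>\<rceil>"
  \<comment> \<open>The sum of ratios covers the finitely many \<open>n\<close> excluded from
    \<open>main\<close>; the summand 1 keeps \<open>L\<close> positive.\<close>
  define L where "L = \<bar>A\<bar> + 1 + (\<Sum>n<N. \<bar>H_norm (k n) f\<bar> / rhs n)"
  have pos: "0 \<le> \<bar>H_norm (k n) f\<bar> / rhs n" for n using rhs[of n] by simp
  have "H_norm (k n) f \<le> L * rhs n" for n
  proof (cases "n < N")
    case True
    then have "\<bar>H_norm (k n) f\<bar> / rhs n \<le> (\<Sum>n<N. \<bar>H_norm (k n) f\<bar> / rhs n)"
      using pos by (intro member_le_sum) auto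
    also have "\<dots> \<le> L" by (simp add: L_def)
    finally show ?thesis using rhs[of n] by (simp add: divide_le_eq)
  next
    case False
    then have "\<rho> \<le> real n" by (simp add: N_def) linarith
    then have "H_norm (k n) f \<le> A * rhs n" by (rule main)
    also have "\<dots> \<le> L * rhs n"
      using rhs[of n] sum_nonneg[of "{..<N}" "\<lambda>n. \<bar>H_norm (k n) f\<bar> / rhs n", OF pos]
      by (intro mult_right_mono) (auto simp: L_def)
    finally show ?thesis .
  qed
  moreover have "0 < L" using sum_nonneg[of "{..<N}" "\<lambda>n. \<bar>H_norm (k n) f\<bar> / rhs n", OF pos]
    by (simp add: L_def)
  ultimately show ?thesis using that unfolding f_def rhs_def by blast
qed

section \<open>Linear spans\<close>

lemma linear_span_scale: "f \<in> E \<Longrightarrow> (\<lambda>x. a * f x) \<in> linear_span E"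
  unfolding linear_span_def by (intro CollectI exI[of _ "{f}"] exI[of _ "\<lambda>_. a"]) auto

lemma linear_span_zero: "(\<lambda>x. 0) \<in> linear_span E"
  unfolding linear_span_def by (intro CollectI exI[of _ "{}"]) auto

lemma linear_span_add:
  assumes "f \<in> linear_span E" "g \<in> linear_span E"
  shows "(\<lambda>x. f x + g x) \<in> linear_span E"
proof -
  obtain F a where F: "finite F" "F \<subseteq> E" "f = (\<lambda>x. \<Sum>h\<in>F. a h * h x)"
    using assms(1) unfolding linear_span_def by blast
  obtain G b where G: "finite G" "G \<subseteq> E" "g = (\<lambda>x. \<Sum>h\<in>G. b h * h x)"
    using assms(2) unfolding linear_span_def by blast
  \<comment> \<open>A function occurring in both finite sets must receive the sum of its two
    coefficients.\<close>
  define e where "e h = (if h \<in> F then a h else 0) + (if h \<in> G then b h else 0)" for h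
  have "f x + g x = (\<Sum>h\<in>F \<union> G. e h * h x)" for x
  proof -
    have "f x = (\<Sum>h\<in>F \<union> G. (if h \<in> F then a h else 0) * h x)"
      unfolding F(3) by (rule sum.mono_neutral_cong_left) (use F(1) G(1) in auto)
    moreover have "g x = (\<Sum>h\<in>F \<union> G. (if h \<in> G then b h else 0) * h x)"
      unfolding G(3) by (rule sum.mono_neutral_cong_left) (use F(1) G(1) in auto)
    ultimately show ?thesis by (simp add: e_def distrib_right sum.distrib)
  qed
  then show ?thesis
    unfolding linear_span_def using F(1,2) G(1,2) by (intro CollectI exI[of _ "F \<union> G"] exI[of _ e]) auto
qed

lemma linear_span_sum:
  assumes "finite I" "\<And>i. i \<in> I \<Longrightarrow> g i \<in> linear_span E"
  shows "(\<lambda>x. \<Sum>i\<in>I. g i x) \<in> linear_span E"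
  using assms by (induction I) (auto intro: linear_span_zero linear_span_add)

section \<open>Convergence of test functions\<close>

text \<open>Uniform convergence of all derivatives with supports in a common ball. The condition is
  diagonal: the n-th term is controlled for words of length up to \<open>n\<close> with error
  \<open>1 / real (Suc n)\<close>, so one approximation for each \<open>n\<close> suffices to build
  the sequence.\<close>

definition test_converges :: "(nat \<Rightarrow> real^'d::finite \<Rightarrow> real) \<Rightarrow> (real^'d \<Rightarrow> real) \<Rightarrow> bool" where
  "test_converges w \<phi> \<longleftrightarrow> (\<forall>n. smooth (w n)) \<and> smooth \<phi> \<and>
     (\<exists>R. \<forall>x. R < norm x \<longrightarrow> \<phi> x = 0 \<and> (\<forall>n. w n x = 0)) \<and>
     (\<forall>js n x. length js \<le> n \<longrightarrow> \<bar>foldr partial js (w n) x - foldr partial js \<phi> x\<bar> \<le> 1 / real (Suc n))"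

text \<open>Dominated convergence, order by order. An arbitrary \<open>f\<close> is subtracted
  because the balls generating \<open>D_topology\<close> have arbitrary test functions as
  centres.\<close>

lemma test_converges_H_norm:
  fixes w :: "nat \<Rightarrow> real^'d::finite \<Rightarrow> real"
  assumes conv: "test_converges w \<phi>" and f: "f \<in> test_functions" and k: "k \<in> weight_index"
  shows "(\<lambda>n. H_norm k (\<lambda>x. w n x - f x)) \<longlonglongrightarrow> H_norm k (\<lambda>x. \<phi> x - f x)"
proof -
  obtain R0 where R0: "\<And>x. R0 < norm x \<Longrightarrow> \<phi> x = 0" "\<And>x n. R0 < norm x \<Longrightarrow> w n x = 0"
    and sm: "\<And>n. smooth (w n)" "smooth \<phi>"
    and close: "\<And>js n x. length js \<le> n \<Longrightarrow> \<bar>foldr partial js (w n) x - foldr partial js \<phi> x\<bar> \<le> 1 / real (Suc n)"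
    using conv unfolding test_converges_def by blast
  obtain R1 where R1: "\<And>x. R1 < norm x \<Longrightarrow> f x = 0" and smf: "smooth f"
    using f unfolding test_functions_iff_bounded by blast
  define R where "R = max R0 R1"
  have meas: "(\<lambda>x. \<bar>foldr partial js g x\<bar>\<^sup>2 * snd k x) \<in> borel_measurable lborel" if "smooth g" for js g
    using that by (auto intro!: borel_measurable_continuous_onI continuous_intros smooth_continuous_on weight_continuous_on k)
  have "(\<lambda>n. \<integral>x. \<bar>D_multi \<beta> (\<lambda>x. w n x - f x) x\<bar>\<^sup>2 * snd k x \<partial>lborel)
      \<longlonglongrightarrow> (\<integral>x. \<bar>D_multi \<beta> (\<lambda>x. \<phi> x - f x) x\<bar>\<^sup>2 * snd k x \<partial>lborel)" for \<beta>
  proof -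
    \<comment> \<open>The derivative of order \<open>\<beta>\<close> is controlled only from index
      \<open>N\<close> on, so the sequence is shifted by \<open>N\<close>.\<close>
    define N where "N = length (dlist \<beta>)"
    define D where "D = foldr partial (dlist \<beta>)"
    have D_conv: "\<bar>D (w (n + N)) x - D \<phi> x\<bar> \<le> 1 / real (Suc n)" for n x
    proof -
      have "1 / real (Suc (n + N)) \<le> 1 / real (Suc n)" by (intro frac_le) auto
      with close[of "dlist \<beta>" "n + N" x] show ?thesis unfolding D_def N_def by linarith
    qed
    have D_diff: "D (\<lambda>x. g x - f x) x = D g x - D f x" if "smooth g" for g x
      unfolding D_def by (simp add: foldr_partial_diff[OF that smf])
    have "(\<lambda>n. \<integral>x. \<bar>D (\<lambda>x. w (n + N) x - f x) x\<bar>\<^sup>2 * snd k x \<partial>lborel)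
        \<longlonglongrightarrow> (\<integral>x. \<bar>D (\<lambda>x. \<phi> x - f x) x\<bar>\<^sup>2 * snd k x \<partial>lborel)"
    proof (rule integral_dominated_convergence)
      \<comment> \<open>The majorant comes from the triangle inequality, the error in the derivative
        being at most 1.\<close>
      show "integrable lborel (\<lambda>x. indicator (cball 0 R) x *\<^sub>R ((1 + \<bar>D \<phi> x - D f x\<bar>)\<^sup>2 * snd k x))"
        unfolding D_def
        by (intro borel_integrable_compact continuous_intros smooth_continuous_on weight_continuous_on k sm smf compact_cball)
      show "AE x in lborel. (\<lambda>n. \<bar>D (\<lambda>x. w (n + N) x - f x) x\<bar>\<^sup>2 * snd k x) \<longlonglongrightarrow> \<bar>D (\<lambda>x. \<phi> x - f x) x\<bar>\<^sup>2 * snd k x"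
      proof (intro AE_I2)
        fix x
        have "(\<lambda>n. D (w (n + N)) x - D \<phi> x) \<longlonglongrightarrow> 0"
          by (rule Lim_null_comparison[OF _ LIMSEQ_Suc[OF lim_1_over_n]]) (use D_conv in auto)
        then have "(\<lambda>n. D (w (n + N)) x) \<longlonglongrightarrow> D \<phi> x" by (rule LIM_zero_cancel)
        then show "(\<lambda>n. \<bar>D (\<lambda>x. w (n + N) x - f x) x\<bar>\<^sup>2 * snd k x) \<longlonglongrightarrow> \<bar>D (\<lambda>x. \<phi> x - f x) x\<bar>\<^sup>2 * snd k x"
          unfolding D_diff[OF sm(1)] D_diff[OF sm(2)] by (intro tendsto_intros)
      qed
      show "AE x in lborel. norm (\<bar>D (\<lambda>x. w (n + N) x - f x) x\<bar>\<^sup>2 * snd k x)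
          \<le> indicator (cball 0 R) x *\<^sub>R ((1 + \<bar>D \<phi> x - D f x\<bar>)\<^sup>2 * snd k x)" for n
      proof (intro AE_I2)
        fix x
        have k0: "0 \<le> snd k x" using k by (auto simp: weight_index_def intro: order_trans[OF zero_le_one])
        show "norm (\<bar>D (\<lambda>x. w (n + N) x - f x) x\<bar>\<^sup>2 * snd k x)
          \<le> indicator (cball 0 R) x *\<^sub>R ((1 + \<bar>D \<phi> x - D f x\<bar>)\<^sup>2 * snd k x)"
        proof (cases "R < norm x")
          case True
          then have "D (\<lambda>x. w (n + N) x - f x) x = 0"
            unfolding D_def by (intro foldr_partial_zero_outside_ball[of _ R] smooth_diff sm smf) (auto simp: R_def R0 R1)
          then show ?thesis using True by simp
        next
          case False
          have "1 / real (Suc n) \<le> 1" by simp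
          with D_conv[of n x] have "\<bar>D (w (n + N)) x - D f x\<bar> \<le> 1 + \<bar>D \<phi> x - D f x\<bar>" by linarith
          then have "\<bar>D (w (n + N)) x - D f x\<bar>\<^sup>2 \<le> (1 + \<bar>D \<phi> x - D f x\<bar>)\<^sup>2" by (intro power_mono) auto
          then show ?thesis
            using False k0 unfolding D_diff[OF sm(1)] by (auto simp: abs_mult intro!: mult_right_mono)
        qed
      qed
      show "(\<lambda>x. \<bar>D (\<lambda>x. w (n + N) x - f x) x\<bar>\<^sup>2 * snd k x) \<in> borel_measurable lborel" for n
        unfolding D_def by (intro meas smooth_diff sm smf)
      show "(\<lambda>x. \<bar>D (\<lambda>x. \<phi> x - f x) x\<bar>\<^sup>2 * snd k x) \<in> borel_measurable lborel"
        unfolding D_def by (intro meas smooth_diff sm smf)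
    qed
    then show ?thesis
      unfolding D_multi_eq D_def by (rule LIMSEQ_offset)
  qed
  then show ?thesis
    unfolding H_norm_def by (intro tendsto_real_sqrt tendsto_sum)
qed

lemma smooth_one: "smooth (\<lambda>_::real^'d::finite. 1)"
proof -
  have "\<exists>a. foldr partial js (\<lambda>_::real^'d. 1) = (\<lambda>_. a)" for js
  proof (induction js)
    case (Cons i js)
    then obtain a where "foldr partial js (\<lambda>_::real^'d. 1) = (\<lambda>_. a)" by auto
    then show ?case by (auto simp: partial_def[abs_def])
  qed auto
  then show ?thesis
    unfolding smooth_def differentiable_on_def by (metis differentiable_const)
qed

lemma topspace_D_topology: "topspace D_topology = test_functions"
proof -
  have "g \<in> \<Union>{{g \<in> test_functions. p (\<lambda>x. g x - f x) < e} | p f e.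
      p \<in> H_norm ` weight_index \<and> f \<in> test_functions \<and> 0 < e}" if g: "g \<in> test_functions" for g :: "real^'d::finite \<Rightarrow> real"
  proof -
    \<comment> \<open>The weight 1 with order 0 provides one norm, which is enough to put every test
      function into a generating ball.\<close>
    define k where "k = (0 :: nat, \<lambda>_::real^'d. 1 :: real)"
    have "k \<in> weight_index" using smooth_one by (auto simp: k_def weight_index_def)
    moreover have "H_norm k (\<lambda>x. g x - g x) < 1"
      using H_norm_scale[of g k 0] g by (simp add: test_functions_def)
    ultimately show ?thesis using g by (intro UnionI[of "{h \<in> test_functions. H_norm k (\<lambda>x. h x - g x) < 1}"]) (auto intro!: exI[of _ "H_norm k"] exI[of _ g] exI[of _ 1])
  qed
  then show ?thesis
    unfolding D_topology_def projective_topology_def topology_generated_by_topspace by blast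
qed

text \<open>Induction over the generation of the topology: the property passes to binary
  intersections and to unions, and for a generating ball it is the convergence of norms.\<close>

lemma test_converges_eventually_in_open:
  assumes conv: "test_converges w \<phi>" and U: "openin D_topology U" and "\<phi> \<in> U"
  shows "\<forall>\<^sub>F n in sequentially. w n \<in> U"
proof -
  have w: "w n \<in> test_functions" for n
    using conv unfolding test_converges_def test_functions_iff_bounded by blast
  from U[unfolded D_topology_def projective_topology_def openin_topology_generated_by_iff] \<open>\<phi> \<in> U\<close>
  show ?thesis
  proof (induction rule: generate_topology_on.induct)
    case (Int a b)
    then show ?case by (auto intro: eventually_conj)
  next
    case (UN \<K>)
    then obtain X where "X \<in> \<K>" "\<phi> \<in> X" by blast
    with UN.IH[of X] show ?case by (auto elim: eventually_mono)
  next
    case (Basis s)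
    then obtain k f e where s: "s = {g \<in> test_functions. H_norm k (\<lambda>x. g x - f x) < e}"
      "k \<in> weight_index" "f \<in> test_functions" by auto
    from order_tendstoD(2)[OF test_converges_H_norm[OF conv s(3,2)], of e] Basis(2)
    show ?case by (auto simp: s(1) w)
  qed auto
qed

lemma D_topology_dense:
  assumes "\<And>\<phi>. \<phi> \<in> test_functions \<Longrightarrow> \<exists>w. test_converges w \<phi> \<and> (\<forall>n. w n \<in> L)"
  shows "D_topology closure_of L = test_functions"
proof -
  have "\<exists>y. y \<in> L \<and> y \<in> U" if \<phi>: "\<phi> \<in> test_functions" and U: "\<phi> \<in> U" "openin D_topology U" for \<phi> U
  proof -
    obtain w where w: "test_converges w \<phi>" "\<And>n. w n \<in> L" using assms[OF \<phi>] by blast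
    from test_converges_eventually_in_open[OF w(1) U(2,1)] w(2) show ?thesis
      by (auto simp: eventually_sequentially)
  qed
  then show ?thesis by (auto simp: in_closure_of topspace_D_topology)
qed

section \<open>Approximation by convolution\<close>

lemma integrable_compact_support:
  fixes f :: "'a::euclidean_space \<Rightarrow> real"
  assumes "continuous_on UNIV f" "compact T" "\<And>x. x \<notin> T \<Longrightarrow> f x = 0"
  shows "integrable lborel f"
proof -
  have "(\<lambda>x. indicator T x *\<^sub>R f x) = f" using assms(3) by (auto simp: fun_eq_iff indicator_def)
  then show ?thesis
    using borel_integrable_compact[OF assms(2) continuous_on_subset[OF assms(1)]] by simp
qed

lemma bounded_compact_support:
  fixes f :: "'a::topological_space \<Rightarrow> real"
  assumes "continuous_on UNIV f" "compact T" "\<And>x. x \<notin> T \<Longrightarrow> f x = 0"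
  obtains M where "0 < M" "\<And>x. \<bar>f x\<bar> \<le> M"
proof -
  have "bounded (f ` T)"
    using assms by (intro compact_imp_bounded compact_continuous_image) (auto intro: continuous_on_subset)
  then obtain M where "0 < M" "\<And>x. x \<in> T \<Longrightarrow> \<bar>f x\<bar> \<le> M"
    unfolding bounded_pos by auto
  with that[of M] assms(3) show ?thesis by (metis abs_zero less_imp_le)
qed

lemma uniformly_continuous_compact_support:
  fixes f :: "'a::euclidean_space \<Rightarrow> real"
  assumes "continuous_on UNIV f" "\<And>x. R < norm x \<Longrightarrow> f x = 0"
  shows "uniformly_continuous_on UNIV f"
  unfolding uniformly_continuous_on_def
proof (intro allI impI)
  fix e :: real assume e: "0 < e"
  have "uniformly_continuous_on (cball 0 (R + 1)) f"
    using assms(1) by (intro compact_uniformly_continuous) (auto intro: continuous_on_subset)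
  then obtain d where d: "0 < d"
    "\<And>x y. x \<in> cball 0 (R + 1) \<Longrightarrow> y \<in> cball 0 (R + 1) \<Longrightarrow> dist y x < d \<Longrightarrow> dist (f y) (f x) < e"
    using e unfolding uniformly_continuous_on_def by metis
  have "dist (f y) (f x) < e" if "dist y x < min d 1" for x y
  proof (cases "norm x \<le> R + 1 \<and> norm y \<le> R + 1")
    case True
    then show ?thesis using d(2) that by simp
  next
    case False
    have "norm (y - x) < 1" using that by (simp add: dist_norm)
    then have "R < norm x" "R < norm y"
      using False norm_triangle_ineq2[of y x] norm_triangle_ineq2[of x y] by (auto simp: norm_minus_commute)
    then show ?thesis using assms(2) e by simp
  qed
  then show "\<exists>d>0. \<forall>x\<in>UNIV. \<forall>x'\<in>UNIV. dist x' x < d \<longrightarrow> dist (f x') (f x) < e"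
    using d(1) by (intro exI[of _ "min d 1"]) auto
qed

lemma lborel_reflect:
  "lborel = distr lborel borel (\<lambda>y. x - y)" for x :: "'a::euclidean_space"
  by (subst lborel_affine[of "-1" x]) (auto simp: density_1)

lemma integral_reflect:
  fixes f :: "'a::euclidean_space \<Rightarrow> real"
  assumes "f \<in> borel_measurable borel"
  shows "(\<integral>y. f (x - y) \<partial>lborel) = (\<integral>y. f y \<partial>lborel)"
  by (subst (2) lborel_reflect[of x]) (use assms in \<open>simp add: integral_distr\<close>)

text \<open>Relative to \<open>\<integral> G Q\<^sup>m\<close> the mass of \<open>\<bar>G\<bar> Q\<^sup>m\<close> away from the maximum point of \<open>Q\<close> is
  exponentially small, so a sign change of \<open>G\<close> does no harm.\<close>

lemma approximate_identity:
  fixes G Q \<psi> :: "'a::euclidean_space \<Rightarrow> real"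
  assumes G: "continuous_on UNIV G" "\<And>x. x \<notin> T \<Longrightarrow> G x = 0" "compact T" "0 < G 0"
    and Q: "continuous_on UNIV Q" "Q 0 = 1" "\<And>x. x \<in> T \<Longrightarrow> 0 \<le> Q x" "\<And>x. x \<in> T \<Longrightarrow> x \<noteq> 0 \<Longrightarrow> Q x < 1"
    and \<psi>: "uniformly_continuous_on UNIV \<psi>" "\<And>x. \<bar>\<psi> x\<bar> \<le> M"
    and \<epsilon>: "0 < \<epsilon>"
  shows "\<forall>\<^sub>F m in sequentially. 0 < (\<integral>z. G z * Q z ^ m \<partial>lborel) \<and>
    (\<forall>x. \<bar>(\<integral>z. \<psi> (x - z) * (G z * Q z ^ m) \<partial>lborel) - \<psi> x * (\<integral>z. G z * Q z ^ m \<partial>lborel)\<bar>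
        \<le> \<epsilon> * (\<integral>z. G z * Q z ^ m \<partial>lborel))"
proof -
  have [measurable]: "G \<in> borel_measurable borel" "Q \<in> borel_measurable borel" "\<psi> \<in> borel_measurable borel"
    using G(1) Q(1) uniformly_continuous_imp_continuous[OF \<psi>(1)] by (auto intro: borel_measurable_continuous_onI)
  have M: "0 \<le> M" using \<psi>(2)[of 0] by simp
  obtain d1 where d1: "0 < d1" "\<And>x. norm x < d1 \<Longrightarrow> G 0 / 2 < G x"
  proof -
    have "\<forall>\<^sub>F x in at 0. G 0 / 2 < G x"
      using G(1,4) by (intro order_tendstoD(1)[where y = "G 0"]) (auto simp: continuous_on_eq_continuous_at isCont_def)
    then obtain d where "0 < d" "\<And>x. x \<noteq> 0 \<Longrightarrow> norm x < d \<Longrightarrow> G 0 / 2 < G x"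
      by (auto simp: eventually_at)
    with that[of d] G(4) show ?thesis by (metis field_sum_of_halves less_add_same_cancel1 half_gt_zero)
  qed
  obtain d2 where d2: "0 < d2" "\<And>x z. norm z < d2 \<Longrightarrow> \<bar>\<psi> (x - z) - \<psi> x\<bar> \<le> \<epsilon> / 3"
  proof -
    obtain d where "0 < d" and d: "\<And>x y. dist y x < d \<Longrightarrow> dist (\<psi> y) (\<psi> x) < \<epsilon> / 3"
      using \<psi>(1) \<epsilon> unfolding uniformly_continuous_on_def by (metis UNIV_I divide_pos_pos zero_less_numeral)
    then have "\<bar>\<psi> (x - z) - \<psi> x\<bar> < \<epsilon> / 3" if "norm z < d" for x z
      using d[of "x - z" x] that by (simp add: dist_norm)
    with that[of d] \<open>0 < d\<close> show ?thesis by (meson less_imp_le)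
  qed
  \<comment> \<open>Within this radius \<open>G\<close> is positive and \<open>\<psi>\<close> varies
    by at most a third of \<open>\<epsilon>\<close>.\<close>
  define \<rho> where "\<rho> = min d1 d2"
  have \<rho>: "0 < \<rho>" using d1 d2 by (simp add: \<rho>_def)
  \<comment> \<open>Compactness gives a maximum of \<open>Q\<close> on the rest of \<open>T\<close>,
    below 1 since 0 is excluded; if nothing is left, \<open>q = 0\<close> will do.\<close>
  obtain q where q: "0 \<le> q" "q < 1" "\<And>x. x \<in> T \<Longrightarrow> \<rho> \<le> norm x \<Longrightarrow> Q x \<le> q"
  proof (cases "T - ball 0 \<rho> = {}")
    case True
    then have "norm x < \<rho>" if "x \<in> T" for x using that by auto
    with that[of 0] show ?thesis by (meson not_le order_refl zero_less_one)
  next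
    case False
    obtain x where x: "x \<in> T - ball 0 \<rho>" "\<And>y. y \<in> T - ball 0 \<rho> \<Longrightarrow> Q y \<le> Q x"
      using continuous_attains_sup[OF compact_diff[OF G(3) open_ball] False continuous_on_subset[OF Q(1)]] by auto
    then have "x \<noteq> 0" "x \<in> T" using \<rho> by auto
    with that[of "Q x"] x(2) Q(3,4) show ?thesis by auto
  qed
  \<comment> \<open>A level strictly between \<open>q\<close> and 1, exceeded by \<open>Q\<close>
    near 0: the near mass decays no faster than \<open>q' ^ m\<close>, the far mass at least as fast
    as \<open>q ^ m\<close>.\<close>
  define q' where "q' = (1 + q) / 2"
  have q': "q < q'" "0 < q'" "q' < 1" using q by (auto simp: q'_def)
  obtain \<rho>' where \<rho>': "0 < \<rho>'" "\<rho>' \<le> \<rho>" "\<And>x. norm x < \<rho>' \<Longrightarrow> q' < Q x"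
  proof -
    have "\<forall>\<^sub>F x in at 0. q' < Q x"
    proof (rule order_tendstoD(1))
      show "(Q \<longlongrightarrow> Q 0) (at 0)" using Q(1) by (simp add: continuous_on_eq_continuous_at isCont_def)
    qed (use Q(2) q' in simp)
    then obtain d where "0 < d" "\<And>x. x \<noteq> 0 \<Longrightarrow> norm x < d \<Longrightarrow> q' < Q x"
      by (auto simp: eventually_at)
    with that[of "min d \<rho>"] \<rho> q' Q(2) show ?thesis by (metis min.cobounded2 min_less_iff_conj)
  qed
  obtain A where A: "0 < A" "\<And>x. \<bar>G x\<bar> \<le> A" using bounded_compact_support[OF G(1,3,2)] by blast
  define V V' where "V = measure lborel T" and "V' = measure lborel (ball 0 \<rho>' :: 'a set)"
  have V': "0 < V'" using content_ball_pos[OF \<rho>'(1), of "0::'a"] by (simp add: V'_def)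
  define \<eta> where "\<eta> = min (2 * \<epsilon> / 3) 1 * (G 0 / 2 * V')"
  define X where "X = (2 * M + \<epsilon> + 2) * (A * V)"
  have \<eta>: "0 < \<eta>" using \<epsilon> G(4) V' by (simp add: \<eta>_def)
  have "(\<lambda>m. X * (q / q') ^ m) \<longlonglongrightarrow> X * 0"
    using q q' by (intro tendsto_intros LIMSEQ_power_zero) auto
  then have "\<forall>\<^sub>F m in sequentially. X * (q / q') ^ m < \<eta>"
    using \<eta> by (intro order_tendstoD(2)) auto
  then show ?thesis
  proof eventually_elim
    fix m assume "X * (q / q') ^ m < \<eta>"
    then have small: "X * q ^ m < \<eta> * q' ^ m"
      using q' by (simp add: power_divide field_simps)
    define \<kappa> where "\<kappa> z = G z * Q z ^ m" for z
    have \<kappa>_cont: "continuous_on UNIV \<kappa>"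
      unfolding \<kappa>_def[abs_def] by (intro continuous_intros G Q)
    have \<kappa>_int: "integrable lborel \<kappa>"
      by (rule integrable_compact_support[OF \<kappa>_cont G(3)]) (simp add: \<kappa>_def G(2))
    \<comment> \<open>The kernel keeps its sign near 0, where it is nonnegative; far away only its
      absolute value is used.\<close>
    define p1 p2 where "p1 z = indicator (ball 0 \<rho>) z * \<kappa> z" and "p2 z = indicator (- ball 0 \<rho>) z * \<bar>\<kappa> z\<bar>" for z
    have p_int: "integrable lborel p1" "integrable lborel p2"
      using integrable_mult_indicator[of "ball 0 \<rho>" lborel \<kappa>] integrable_mult_indicator[of "- ball 0 \<rho>" lborel "\<lambda>z. \<bar>\<kappa> z\<bar>"] \<kappa>_int
      by (auto simp: p1_def[abs_def] p2_def[abs_def])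
    have \<kappa>_nonneg: "0 \<le> \<kappa> z" if "norm z < \<rho>" for z
    proof (cases "z \<in> T")
      case True
      then show ?thesis using d1(2)[of z] that Q(3) G(4) by (auto simp: \<kappa>_def \<rho>_def)
    qed (simp add: \<kappa>_def G(2))
    have p1_low: "G 0 / 2 * q' ^ m * indicator (ball 0 \<rho>') z \<le> p1 z" for z
    proof (cases "norm z < \<rho>'")
      case True
      then have "G 0 / 2 \<le> G z" "q' ^ m \<le> Q z ^ m"
        using d1(2)[of z] \<rho>'(2) \<rho>'(3)[of z] q' by (auto simp: \<rho>_def intro!: power_mono)
      then have "G 0 / 2 * q' ^ m \<le> \<kappa> z"
        unfolding \<kappa>_def using q' G(4) by (intro mult_mono) auto
      then show ?thesis using True \<rho>'(2) by (simp add: p1_def)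
    next
      case False
      then show ?thesis using \<kappa>_nonneg[of z] by (auto simp: p1_def indicator_def)
    qed
    have p2_up: "p2 z \<le> A * q ^ m * indicator T z" for z
    proof (cases "z \<in> T \<and> \<rho> \<le> norm z")
      case True
      then have "\<bar>G z\<bar> * Q z ^ m \<le> A * q ^ m"
        using A q Q(3) by (intro mult_mono power_mono) auto
      then show ?thesis using True Q(3)[of z] by (simp add: p2_def \<kappa>_def abs_mult)
    next
      case False
      then show ?thesis using A(1) q(1) G(2) by (auto simp: p2_def \<kappa>_def indicator_def)
    qed
    define I J where "I = (\<integral>z. p1 z \<partial>lborel)" and "J = (\<integral>z. p2 z \<partial>lborel)"
    have I: "G 0 / 2 * V' * q' ^ m \<le> I"
    proof -
      have "(\<integral>z. G 0 / 2 * q' ^ m * indicator (ball 0 \<rho>' :: 'a set) z \<partial>lborel) \<le> I"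
        unfolding I_def using p1_low emeasure_lborel_ball_finite[of "0::'a" \<rho>']
        by (intro integral_mono p_int) auto
      then show ?thesis by (simp add: V'_def mult_ac)
    qed
    have J: "J \<le> A * V * q ^ m"
    proof -
      have "J \<le> (\<integral>z. A * q ^ m * indicator T z \<partial>lborel)"
        unfolding J_def using p2_up emeasure_compact_finite[OF G(3)] borel_compact[OF G(3)]
        by (intro integral_mono p_int) (auto simp: less_top)
      then show ?thesis by (simp add: V_def mult_ac)
    qed
    have J0: "0 \<le> J" unfolding J_def by (intro integral_nonneg_AE) (simp add: p2_def)
    have "(2 * M + \<epsilon> + 2) * J \<le> (2 * M + \<epsilon> + 2) * (A * V * q ^ m)"
      using M \<epsilon> by (intro mult_left_mono J) auto
    also have "\<dots> = X * q ^ m" by (simp add: X_def)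
    also have "\<dots> < \<eta> * q' ^ m" by (rule small)
    also have "\<dots> = min (2 * \<epsilon> / 3) 1 * (G 0 / 2 * V' * q' ^ m)" by (simp add: \<eta>_def)
    also have "\<dots> \<le> min (2 * \<epsilon> / 3) 1 * I" using \<epsilon> by (intro mult_left_mono I) auto
    \<comment> \<open>This one estimate yields both \<open>JI1\<close>, for positivity of the total
      mass, and \<open>JI2\<close>, for the error bound.\<close>
    finally have JI: "(2 * M + \<epsilon> + 2) * J < min (2 * \<epsilon> / 3) 1 * I" .
    have I0: "0 < I" using I V' q' G(4) by (smt (verit) divide_pos_pos mult_pos_pos zero_less_power)
    have JI1: "2 * J < I"
    proof -
      have "2 * J \<le> (2 * M + \<epsilon> + 2) * J" using M \<epsilon> J0 by (intro mult_right_mono) auto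
      also note JI
      also have "min (2 * \<epsilon> / 3) 1 * I \<le> 1 * I" using I0 by (intro mult_right_mono) auto
      finally show ?thesis by simp
    qed
    have JI2: "(2 * M + \<epsilon>) * J \<le> 2 * \<epsilon> / 3 * I"
    proof -
      have "(2 * M + \<epsilon>) * J \<le> (2 * M + \<epsilon> + 2) * J" using J0 by (intro mult_right_mono) auto
      also note less_imp_le[OF JI]
      also have "min (2 * \<epsilon> / 3) 1 * I \<le> 2 * \<epsilon> / 3 * I" using I0 by (intro mult_right_mono) auto
      finally show ?thesis by simp
    qed
    have low: "I - J \<le> (\<integral>z. \<kappa> z \<partial>lborel)"
    proof -
      have "I - J = (\<integral>z. p1 z - p2 z \<partial>lborel)" using p_int by (simp add: I_def J_def)
      also have "\<dots> \<le> (\<integral>z. \<kappa> z \<partial>lborel)"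
        by (intro integral_mono Bochner_Integration.integrable_diff p_int \<kappa>_int)
          (auto simp: p1_def p2_def indicator_def)
      finally show ?thesis .
    qed
    have "\<bar>(\<integral>z. \<psi> (x - z) * \<kappa> z \<partial>lborel) - \<psi> x * (\<integral>z. \<kappa> z \<partial>lborel)\<bar> \<le> \<epsilon> * (\<integral>z. \<kappa> z \<partial>lborel)" for x
    proof -
      have \<psi>\<kappa>_int: "integrable lborel (\<lambda>z. \<psi> (x - z) * \<kappa> z)"
      proof (rule Bochner_Integration.integrable_bound[of _ "\<lambda>z. M * \<kappa> z"])
        show "AE z in lborel. norm (\<psi> (x - z) * \<kappa> z) \<le> norm (M * \<kappa> z)"
          using \<psi>(2) M by (intro AE_I2) (auto simp: abs_mult intro!: mult_right_mono)
      qed (use \<kappa>_int in \<open>auto simp: \<kappa>_def[abs_def]\<close>)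
      have "\<bar>(\<integral>z. \<psi> (x - z) * \<kappa> z \<partial>lborel) - \<psi> x * (\<integral>z. \<kappa> z \<partial>lborel)\<bar> = \<bar>\<integral>z. (\<psi> (x - z) - \<psi> x) * \<kappa> z \<partial>lborel\<bar>"
        using \<psi>\<kappa>_int \<kappa>_int by (simp add: left_diff_distrib)
      also have "\<dots> \<le> (\<integral>z. \<bar>(\<psi> (x - z) - \<psi> x) * \<kappa> z\<bar> \<partial>lborel)"
        using integral_norm_bound[of lborel "\<lambda>z. (\<psi> (x - z) - \<psi> x) * \<kappa> z"] by simp
      also have "\<dots> \<le> (\<integral>z. \<epsilon> / 3 * p1 z + 2 * M * p2 z \<partial>lborel)"
      proof (rule integral_mono)
        show "integrable lborel (\<lambda>z. \<bar>(\<psi> (x - z) - \<psi> x) * \<kappa> z\<bar>)"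
          using \<psi>\<kappa>_int \<kappa>_int by (simp add: left_diff_distrib)
        show "integrable lborel (\<lambda>z. \<epsilon> / 3 * p1 z + 2 * M * p2 z)" using p_int by simp
        fix z
        show "\<bar>(\<psi> (x - z) - \<psi> x) * \<kappa> z\<bar> \<le> \<epsilon> / 3 * p1 z + 2 * M * p2 z"
        proof (cases "norm z < \<rho>")
          case True
          then show ?thesis
            using mult_right_mono[OF d2(2)[of z x] \<kappa>_nonneg[of z]] \<kappa>_nonneg[of z]
            by (simp add: p1_def p2_def abs_mult \<rho>_def)
        next
          case False
          have "\<bar>\<psi> (x - z) - \<psi> x\<bar> \<le> 2 * M" using \<psi>(2)[of "x - z"] \<psi>(2)[of x] by linarith
          then show ?thesis using False by (auto simp: p1_def p2_def abs_mult intro!: mult_right_mono)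
        qed
      qed
      also have "\<dots> = \<epsilon> / 3 * I + 2 * M * J" using p_int by (simp add: I_def J_def)
      also have "\<dots> \<le> \<epsilon> * (I - J)" using JI2 by (simp add: algebra_simps)
      also have "\<dots> \<le> \<epsilon> * (\<integral>z. \<kappa> z \<partial>lborel)" using \<epsilon> low by simp
      finally show ?thesis .
    qed
    moreover have "0 < (\<integral>z. \<kappa> z \<partial>lborel)" using low JI1 J0 by linarith
    ultimately show "0 < (\<integral>z. G z * Q z ^ m \<partial>lborel) \<and>
      (\<forall>x. \<bar>(\<integral>z. \<psi> (x - z) * (G z * Q z ^ m) \<partial>lborel) - \<psi> x * (\<integral>z. G z * Q z ^ m \<partial>lborel)\<bar>
          \<le> \<epsilon> * (\<integral>z. G z * Q z ^ m \<partial>lborel))"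
      by (simp add: \<kappa>_def)
  qed
qed

section \<open>Derivatives and Riemann sums of convolutions\<close>

text \<open>The minus sign of integration by parts cancels the one from differentiating
  \<open>\<kappa> (x - y)\<close> in \<open>y\<close>.\<close>

lemma integral_convolution_partial:
  fixes \<phi> \<kappa> :: "real^'d::finite \<Rightarrow> real"
  assumes \<phi>: "\<phi> \<in> test_functions" and \<kappa>: "smooth \<kappa>"
  shows "(\<integral>y. \<phi> y * partial i \<kappa> (x - y) \<partial>lborel) = (\<integral>y. partial i \<phi> y * \<kappa> (x - y) \<partial>lborel)"
proof -
  obtain R where R: "\<And>y. R < norm y \<Longrightarrow> \<phi> y = 0" and sm: "smooth \<phi>"
    using \<phi> unfolding test_functions_iff_bounded by blast
  have R': "partial i \<phi> y = 0" if "R < norm y" for y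
    using foldr_partial_zero_outside_ball[OF sm R that, of "[i]"] by simp
  note cont = smooth_continuous_on[OF sm, of UNIV "[]", simplified] smooth_continuous_on[OF sm, of UNIV "[i]", simplified]
  have "continuous_on UNIV (\<lambda>y. x - y)" by (intro continuous_intros)
  from continuous_on_compose2[OF smooth_continuous_on[OF \<kappa>, of UNIV "[]"] this]
    continuous_on_compose2[OF smooth_continuous_on[OF \<kappa>, of UNIV "[i]"] this]
  have cont\<kappa>: "continuous_on UNIV (\<lambda>y. \<kappa> (x - y))" "continuous_on UNIV (\<lambda>y. partial i \<kappa> (x - y))"
    by simp_all
  define u u' where "u y = \<phi> y * \<kappa> (x - y)" and "u' y = partial i \<phi> y * \<kappa> (x - y) - \<phi> y * partial i \<kappa> (x - y)" for y
  have cont_u: "continuous_on UNIV u" "continuous_on UNIV u'"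
    unfolding u_def[abs_def] u'_def[abs_def] by (intro continuous_intros cont cont\<kappa>)+
  obtain M where M: "0 < M" "\<And>y. \<bar>u' y\<bar> \<le> M"
    using bounded_compact_support[OF cont_u(2) compact_cball[of 0 R]] R R' by (auto simp: u'_def)
  have "(\<integral>y. u' y \<partial>lborel) = 0"
  proof (rule integral_directional_derivative_eq_0[where e = "axis i 1" and u = u and w = "\<lambda>y. M * indicator (cball 0 (R + 1)) y"])
    show "integrable lborel u"
      by (rule integrable_compact_support[OF cont_u(1) compact_cball[of 0 R]]) (simp add: u_def R)
    show "u' \<in> borel_measurable borel" using cont_u(2) by (rule borel_measurable_continuous_onI)
    show "integrable lborel (\<lambda>y::real^'d. M * indicator (cball 0 (R + 1)) y)"
      using emeasure_lborel_cball_finite[of "0::real^'d" "R + 1"]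
      by (intro integrable_mult_right integrable_real_indicator) auto
    fix y t
    have "((\<lambda>t. \<kappa> (x - (y + t *\<^sub>R axis i 1))) has_real_derivative - partial i \<kappa> (x - (y + t *\<^sub>R axis i 1))) (at t)"
    proof -
      have *: "((\<lambda>s. \<kappa> (x - y + s *\<^sub>R axis i 1)) has_real_derivative partial i \<kappa> (x - y + (- t) *\<^sub>R axis i 1)) (at (- t))"
        using foldr_partial_DERIV[OF \<kappa>, of "[]" "x - y" i "- t"] by simp
      show ?thesis
        using DERIV_chain2[OF * DERIV_minus[OF DERIV_ident]] by (simp add: algebra_simps)
    qed
    from DERIV_mult[OF foldr_partial_DERIV[OF sm, of "[]", simplified] this]
    show "((\<lambda>t. u (y + t *\<^sub>R axis i 1)) has_real_derivative u' (y + t *\<^sub>R axis i 1)) (at t)"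
      by (simp add: u_def u'_def algebra_simps)
    assume t: "0 \<le> t" "t \<le> 1"
    show "\<bar>u' (y + t *\<^sub>R axis i 1)\<bar> \<le> M * indicator (cball 0 (R + 1)) y"
    proof (cases "norm y \<le> R + 1")
      case False
      have "norm (y + t *\<^sub>R axis i 1) \<ge> norm y - norm (t *\<^sub>R axis i (1::real) :: real^'d)"
        by (metis norm_diff_ineq)
      then have "R < norm (y + t *\<^sub>R axis i 1)" using False t by simp
      then show ?thesis using False by (simp add: u'_def R R')
    qed (use M in simp)
  qed
  moreover have "integrable lborel (\<lambda>y. partial i \<phi> y * \<kappa> (x - y))" "integrable lborel (\<lambda>y. \<phi> y * partial i \<kappa> (x - y))"
    by (rule integrable_compact_support[OF _ compact_cball[of 0 R]];
        auto intro!: continuous_intros cont cont\<kappa> simp: R R')+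
  ultimately show ?thesis by (simp add: u'_def)
qed

lemma test_functions_partial: "\<phi> \<in> test_functions \<Longrightarrow> foldr partial js \<phi> \<in> test_functions"
  unfolding test_functions_iff_bounded
  using smooth_foldr_partial foldr_partial_zero_outside_ball by meson

text \<open>The outermost derivative of the kernel is moved first and becomes the innermost one on
  \<open>\<phi>\<close>; hence the reversed word.\<close>

lemma integral_convolution_foldr_partial:
  fixes \<phi> \<kappa> :: "real^'d::finite \<Rightarrow> real"
  assumes "\<phi> \<in> test_functions" "smooth \<kappa>"
  shows "(\<integral>y. \<phi> y * foldr partial js \<kappa> (x - y) \<partial>lborel) = (\<integral>y. foldr partial (rev js) \<phi> y * \<kappa> (x - y) \<partial>lborel)"
  using assms(1)
proof (induction js arbitrary: \<phi>)
  case (Cons i js)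
  have "(\<integral>y. \<phi> y * foldr partial (i # js) \<kappa> (x - y) \<partial>lborel) = (\<integral>y. partial i \<phi> y * foldr partial js \<kappa> (x - y) \<partial>lborel)"
    using integral_convolution_partial[OF Cons.prems smooth_foldr_partial[OF assms(2)]] by simp
  also have "\<dots> = (\<integral>y. foldr partial (rev js) (partial i \<phi>) y * \<kappa> (x - y) \<partial>lborel)"
    using Cons.IH test_functions_partial[OF Cons.prems, of "[i]"] by simp
  finally show ?case by simp
qed simp

text \<open>The mesh \<open>\<delta>\<close> has to be uniform in \<open>x\<close>. Uniform
  continuity of both factors provides this: \<open>\<phi> y * \<psi> (x - y)\<close> varies in
  \<open>y\<close> at a rate independent of \<open>x\<close>.\<close>

lemma convolution_Riemann_sum:
  fixes \<phi> \<psi> :: "'a::euclidean_space \<Rightarrow> real"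
  assumes \<phi>: "continuous_on UNIV \<phi>" "\<And>y. R < norm y \<Longrightarrow> \<phi> y = 0" "\<And>y. y \<notin> cbox a b \<Longrightarrow> \<phi> y = 0"
    and \<psi>: "continuous_on UNIV \<psi>" "\<And>y. R' < norm y \<Longrightarrow> \<psi> y = 0" and e: "0 < e"
  shows "\<exists>\<delta>>0. \<forall>p. p tagged_division_of (cbox a b) \<longrightarrow> (\<lambda>y. ball y \<delta>) fine p \<longrightarrow>
    (\<forall>x. \<bar>(\<Sum>(y, K)\<in>p. measure lborel K * (\<phi> y * \<psi> (x - y))) - (\<integral>y. \<phi> y * \<psi> (x - y) \<partial>lborel)\<bar> \<le> e)"
proof -
  obtain M where M: "0 < M" "\<And>y. \<bar>\<phi> y\<bar> \<le> M"
    using bounded_compact_support[OF \<phi>(1) compact_cball[of 0 R]] \<phi>(2) by auto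
  obtain M' where M': "0 < M'" "\<And>y. \<bar>\<psi> y\<bar> \<le> M'"
    using bounded_compact_support[OF \<psi>(1) compact_cball[of 0 R']] \<psi>(2) by auto
  define v where "v = measure lborel (cbox a b)"
  \<comment> \<open>The summand 1 keeps the denominator positive when the box has volume 0.\<close>
  define \<eta> where "\<eta> = e / (v + 1)"
  have "0 \<le> v" by (simp add: v_def)
  then have \<eta>: "0 < \<eta>" "\<eta> * v \<le> e"
    using e by (auto simp: \<eta>_def field_simps)
  obtain d where d: "0 < d" "\<And>y y'. dist y' y < d \<Longrightarrow> dist (\<phi> y') (\<phi> y) < \<eta> / (2 * M')"
    using uniformly_continuous_compact_support[OF \<phi>(1,2)] \<eta> M' unfolding uniformly_continuous_on_def
    by (metis UNIV_I divide_pos_pos mult_pos_pos zero_less_numeral)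
  obtain d' where d': "0 < d'" "\<And>y y'. dist y' y < d' \<Longrightarrow> dist (\<psi> y') (\<psi> y) < \<eta> / (2 * M)"
    using uniformly_continuous_compact_support[OF \<psi>(1,2)] \<eta> M unfolding uniformly_continuous_on_def
    by (metis UNIV_I divide_pos_pos mult_pos_pos zero_less_numeral)
  define \<delta> where "\<delta> = min d d'"
  define F where "F x y = \<phi> y * \<psi> (x - y)" for x y
  have F_close: "\<bar>F x y - F x y'\<bar> \<le> \<eta>" if "dist y y' < \<delta>" for x y y'
  proof -
    have 1: "\<bar>\<phi> y\<bar> * \<bar>\<psi> (x - y) - \<psi> (x - y')\<bar> \<le> M * (\<eta> / (2 * M))"
    proof (rule mult_mono[OF M(2)])
      have "dist (x - y) (x - y') < d'" using that by (simp add: \<delta>_def dist_norm norm_minus_commute)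
      then show "\<bar>\<psi> (x - y) - \<psi> (x - y')\<bar> \<le> \<eta> / (2 * M)"
        using d'(2) by (fastforce simp: dist_real_def)
    qed (use M in auto)
    have 2: "\<bar>\<phi> y - \<phi> y'\<bar> * \<bar>\<psi> (x - y')\<bar> \<le> \<eta> / (2 * M') * M'"
    proof (rule mult_mono[OF _ M'(2)])
      show "\<bar>\<phi> y - \<phi> y'\<bar> \<le> \<eta> / (2 * M')"
        using d(2)[of y y'] that by (simp add: \<delta>_def dist_real_def)
    qed (use M' \<eta> in auto)
    have "F x y - F x y' = \<phi> y * (\<psi> (x - y) - \<psi> (x - y')) + (\<phi> y - \<phi> y') * \<psi> (x - y')"
      by (simp add: F_def algebra_simps)
    then have "\<bar>F x y - F x y'\<bar> \<le> \<bar>\<phi> y\<bar> * \<bar>\<psi> (x - y) - \<psi> (x - y')\<bar> + \<bar>\<phi> y - \<phi> y'\<bar> * \<bar>\<psi> (x - y')\<bar>"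
      by (metis abs_mult abs_triangle_ineq)
    also have "\<dots> \<le> M * (\<eta> / (2 * M)) + \<eta> / (2 * M') * M'" by (rule add_mono[OF 1 2])
    also have "\<dots> = \<eta>" using M M' by simp
    finally show ?thesis .
  qed
  have F_cont: "continuous_on A (F x)" for A x
  proof -
    have "continuous_on UNIV (\<lambda>y. \<psi> (x - y))"
      by (rule continuous_on_compose2[OF \<psi>(1)]) (auto intro!: continuous_intros)
    then show ?thesis
      unfolding F_def[abs_def] using \<phi>(1) by (intro continuous_on_mult) (auto intro: continuous_on_subset)
  qed
  have F_int: "F x integrable_on cbox u v" for x u v
    by (rule integrable_continuous[OF F_cont])
  have F_total: "(\<integral>y. F x y \<partial>lborel) = integral (cbox a b) (F x)" for x
  proof -
    have "integrable lborel (F x)"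
      by (rule integrable_compact_support[OF F_cont compact_cball[of 0 R]]) (simp add: F_def \<phi>(2))
    then have "(\<integral>y. F x y \<partial>lborel) = integral UNIV (F x)" by (simp add: integral_lborel)
    also have "\<dots> = integral (cbox a b) (F x)"
      unfolding integral_restrict_UNIV[of "cbox a b", symmetric]
      by (intro arg_cong[where f = "integral UNIV"]) (auto simp: fun_eq_iff F_def \<phi>(3))
    finally show ?thesis .
  qed
  have "\<bar>(\<Sum>(y, K)\<in>p. measure lborel K * F x y) - (\<integral>y. F x y \<partial>lborel)\<bar> \<le> e"
    if p: "p tagged_division_of (cbox a b)" and fine: "(\<lambda>y. ball y \<delta>) fine p" for p x
  proof -
    have "(\<Sum>(y, K)\<in>p. measure lborel K * F x y) - (\<integral>y. F x y \<partial>lborel) = (\<Sum>(y, K)\<in>p. measure lborel K * F x y - integral K (F x))"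
      unfolding F_total integral_combine_tagged_division_topdown[OF F_int p]
      by (simp add: sum_subtractf case_prod_unfold)
    also have "\<bar>\<dots>\<bar> \<le> (\<Sum>(y, K)\<in>p. \<bar>measure lborel K * F x y - integral K (F x)\<bar>)"
      by (rule order_trans[OF sum_abs]) (simp add: case_prod_unfold)
    also have "\<dots> \<le> (\<Sum>(y, K)\<in>p. \<eta> * measure lborel K)"
    proof (rule sum_mono, clarify)
      fix y K assume yK: "(y, K) \<in> p"
      obtain u v where K: "K = cbox u v" using tagged_division_ofD(4)[OF p yK] by blast
      have "K \<subseteq> ball y \<delta>" using fine yK by (auto simp: fine_def)
      have int: "((\<lambda>z. F x y - F x z) has_integral (measure lborel (cbox u v) * F x y - integral (cbox u v) (F x))) (cbox u v)"
        using has_integral_diff[OF has_integral_const[of "F x y" u v] integrable_integral[OF F_int[of x u v]]] by simp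
      have "norm (F x y - F x z) \<le> \<eta>" if "z \<in> cbox u v" for z
        using that \<open>K \<subseteq> ball y \<delta>\<close> F_close[of y z x] unfolding K by auto
      from has_integral_bound[OF less_imp_le[OF \<eta>(1)] int this]
      show "\<bar>measure lborel K * F x y - integral K (F x)\<bar> \<le> \<eta> * measure lborel K"
        by (simp add: K)
    qed
    also have "\<dots> = \<eta> * measure lborel (cbox a b)"
      using additive_content_tagged_division[OF p] by (simp add: case_prod_unfold sum_distrib_left[symmetric])
    finally show ?thesis using \<eta>(2) by (simp add: v_def)
  qed
  moreover have "0 < \<delta>" using d(1) d'(1) by (simp add: \<delta>_def)
  ultimately show ?thesis unfolding F_def by blast
qed

lemma tens_translated: "tens (translated F y) \<alpha> x = tens (\<lambda>_. F) \<alpha> (x - y)"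
  by (simp add: tens_def)

lemma parabola_bounds:
  fixes r s t :: real
  assumes "\<bar>t\<bar> \<le> s" "s < r"
  shows "0 \<le> 1 - (t / r)\<^sup>2" "1 - (t / r)\<^sup>2 \<le> 1"
proof -
  have "\<bar>t / r\<bar> \<le> 1" using assms by (simp add: abs_divide)
  then have "(t / r)\<^sup>2 \<le> 1" using abs_square_le_1 by blast
  then show "0 \<le> 1 - (t / r)\<^sup>2" "1 - (t / r)\<^sup>2 \<le> 1" by simp_all
qed

section \<open>Density of the span\<close>

text \<open>The power \<open>m\<close> is fixed first, for all words of length at most
  \<open>n\<close> at once, and then the partition. For fixed \<open>m\<close> the kernel is a
  product of small sequences, so every term of a Riemann sum lies in the span.\<close>

lemma test_function_approximation:
  fixes \<phi> :: "real^'d::finite \<Rightarrow> real"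
  assumes c: "\<And>n. 0 < c n" "incseq c" and F: "small_seq c F" "0 < F 0 0"
    and \<phi>: "\<phi> \<in> test_functions"
    and span: "\<And>G (y :: real^'d) a. small_seq c G \<Longrightarrow> (\<lambda>x. a * tens (translated G y) (\<lambda>_. 0) x) \<in> linear_span E"
  shows "\<exists>w. test_converges w \<phi> \<and> (\<forall>n. w n \<in> linear_span E)"
proof -
  obtain R0 where R0: "\<And>n x. R0 < \<bar>x\<bar> \<Longrightarrow> F n x = 0" and dF: "deriv_seq F"
    using F(1) unfolding small_seq_def by blast
  obtain R1 where R1: "\<And>x. R1 < norm x \<Longrightarrow> \<phi> x = 0" and sm: "smooth \<phi>"
    using \<phi> unfolding test_functions_iff_bounded by blast
  \<comment> \<open>Strictly larger than the half-width of \<open>T\<close>, so that the parabolas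
    are positive on \<open>T\<close>.\<close>
  define r where "r = \<bar>R0\<bar> + 1"
  define T where "T = (cbox (\<chi> i. - \<bar>R0\<bar>) (\<chi> i. \<bar>R0\<bar>) :: (real^'d) set)"
  have T_iff: "x \<in> T \<longleftrightarrow> (\<forall>i. \<bar>x $ i\<bar> \<le> \<bar>R0\<bar>)" for x
    by (auto simp: T_def mem_box_cart abs_le_iff minus_le_iff)
  define G0 where "G0 x = (\<Prod>i\<in>UNIV. F 0 (x $ i))" for x :: "real^'d"
  define Q where "Q x = (\<Prod>i\<in>UNIV. 1 - (x $ i / r)\<^sup>2)" for x :: "real^'d"
  have cont_F: "continuous_on A (F 0)" for A by (rule deriv_seq_continuous_on[OF dF])
  have G0: "continuous_on UNIV G0" "\<And>x. x \<notin> T \<Longrightarrow> G0 x = 0" "0 < G0 0"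
  proof -
    show "continuous_on UNIV G0"
      unfolding G0_def[abs_def]
      by (intro continuous_on_prod continuous_on_compose2[OF cont_F[of UNIV]] continuous_intros) auto
    show "G0 x = 0" if x: "x \<notin> T" for x
    proof -
      obtain i where "\<not> \<bar>x $ i\<bar> \<le> \<bar>R0\<bar>" using x T_iff by blast
      then have "F 0 (x $ i) = 0" by (intro R0) linarith
      then show ?thesis unfolding G0_def by (intro prod_zero) auto
    qed
    show "0 < G0 0" using F(2) by (simp add: G0_def)
  qed
  have Q: "continuous_on UNIV Q" "Q 0 = 1" "\<And>x. x \<in> T \<Longrightarrow> 0 \<le> Q x" "\<And>x. x \<in> T \<Longrightarrow> x \<noteq> 0 \<Longrightarrow> Q x < 1"
  proof -
    show "continuous_on UNIV Q"
      unfolding Q_def[abs_def] r_def by (intro continuous_intros) auto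
    show "Q 0 = 1" by (simp add: Q_def)
    have factor: "0 \<le> 1 - (x $ i / r)\<^sup>2" "1 - (x $ i / r)\<^sup>2 \<le> 1" if "x \<in> T" for x i
      using parabola_bounds[of "x $ i" "\<bar>R0\<bar>" r] that by (auto simp: T_iff r_def)
    show "0 \<le> Q x" if "x \<in> T" for x
      unfolding Q_def using factor[OF that] by (intro prod_nonneg) auto
    show "Q x < 1" if x: "x \<in> T" "x \<noteq> 0" for x
    proof -
      obtain i where i: "x $ i \<noteq> 0" using x(2) by (auto simp: vec_eq_iff)
      have "Q x = (1 - (x $ i / r)\<^sup>2) * (\<Prod>j\<in>UNIV - {i}. 1 - (x $ j / r)\<^sup>2)"
        unfolding Q_def by (subst prod.remove[of _ i]) auto
      also have "\<dots> \<le> (1 - (x $ i / r)\<^sup>2) * 1"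
        using factor[OF x(1)] by (intro mult_left_mono prod_le_1) auto
      also have "\<dots> < 1" using i by (simp add: r_def)
      finally show ?thesis .
    qed
  qed
  have "\<forall>m. \<exists>G. small_seq c G \<and> G 0 = (\<lambda>x. (1 - (x / r)\<^sup>2) ^ m * F 0 x)"
    using small_seq_times_parabola_power[OF c F(1)] by metis
  then obtain G where G: "\<And>m. small_seq c (G m)" "\<And>m. G m 0 = (\<lambda>x. (1 - (x / r)\<^sup>2) ^ m * F 0 x)"
    by metis
  have dG: "deriv_seq (G m)" for m using G(1) by (simp add: small_seq_def)
  define \<kappa> where "\<kappa> m = tens (\<lambda>_::'d. G m) (\<lambda>_. 0)" for m
  have \<kappa>_eq: "\<kappa> m z = G0 z * Q z ^ m" for m z
    by (simp add: \<kappa>_def tens_def G(2) G0_def Q_def prod.distrib prod_power_distrib mult.commute)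
  have D_\<kappa>: "foldr partial js (\<kappa> m) = tens (\<lambda>_. G m) (count_list js)" for js m
    unfolding \<kappa>_def by (simp add: foldr_partial_tens dG)
  have \<kappa>_test: "\<kappa> m \<in> test_functions" for m
    using tens_translated_test_function[OF G(1)[of m], where y = 0 and \<alpha> = "\<lambda>_. 0"] by (simp add: \<kappa>_def)
  then have \<kappa>_smooth: "smooth (\<kappa> m)" for m by (simp add: test_functions_def)
  have "bounded (cball (0::real^'d) R1)" by simp
  then obtain b where b: "cball (0::real^'d) R1 \<subseteq> cbox (- b) b"
    by (rule bounded_subset_cbox_symmetric)
  obtain Y where Y: "\<And>y. y \<in> cbox (- b) b \<Longrightarrow> norm y \<le> Y"
    using bounded_cbox[of "- b" b] unfolding bounded_iff by blast
  \<comment> \<open>One radius serves all \<open>m\<close>: each \<open>G m 0\<close> contains the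
    factor \<open>F 0\<close>, and the translations are by points of norm at most
    \<open>Y\<close>.\<close>
  define R where "R = max R1 (real CARD('d) * (R0 + Y))"
  have step: "\<exists>w \<in> linear_span E. smooth w \<and> (\<forall>x. R < norm x \<longrightarrow> w x = 0) \<and>
      (\<forall>js x. length js \<le> n \<longrightarrow> \<bar>foldr partial js w x - foldr partial js \<phi> x\<bar> \<le> e)" if e: "0 < e" for n e
  proof -
    \<comment> \<open>Finiteness of this set of words allows a common \<open>m\<close> and a common
      mesh \<open>\<delta>0\<close>.\<close>
    define L where "L = {js :: 'd list. length js \<le> n}"
    have L: "finite L" using finite_lists_length_le[OF finite[of "UNIV :: 'd set"], of n] by (simp add: L_def)
    have "\<forall>\<^sub>F m in sequentially. \<forall>js\<in>L. 0 < (\<integral>z. \<kappa> m z \<partial>lborel) \<and>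
        (\<forall>x. \<bar>(\<integral>z. foldr partial js \<phi> (x - z) * \<kappa> m z \<partial>lborel) - foldr partial js \<phi> x * (\<integral>z. \<kappa> m z \<partial>lborel)\<bar>
            \<le> e / 2 * (\<integral>z. \<kappa> m z \<partial>lborel))"
    proof (rule eventually_ball_finite[OF L], rule ballI)
      fix js
      have \<psi>: "continuous_on UNIV (foldr partial js \<phi>)" "\<And>x. R1 < norm x \<Longrightarrow> foldr partial js \<phi> x = 0"
        using smooth_continuous_on[OF sm] foldr_partial_zero_outside_ball[OF sm R1] by auto
      obtain M where "0 < M" "\<And>x. \<bar>foldr partial js \<phi> x\<bar> \<le> M"
        using bounded_compact_support[OF \<psi>(1) compact_cball[of 0 R1]] \<psi>(2) by auto
      moreover have "compact T" by (simp add: T_def compact_cbox)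
      ultimately show "\<forall>\<^sub>F m in sequentially. 0 < (\<integral>z. \<kappa> m z \<partial>lborel) \<and>
        (\<forall>x. \<bar>(\<integral>z. foldr partial js \<phi> (x - z) * \<kappa> m z \<partial>lborel) - foldr partial js \<phi> x * (\<integral>z. \<kappa> m z \<partial>lborel)\<bar>
            \<le> e / 2 * (\<integral>z. \<kappa> m z \<partial>lborel))"
        unfolding \<kappa>_eq using e
        by (intro approximate_identity[where M = M, OF G0(1,2) _ G0(3) Q uniformly_continuous_compact_support[OF \<psi>]]) auto
    qed
    then obtain m where m: "\<And>js. js \<in> L \<Longrightarrow> 0 < (\<integral>z. \<kappa> m z \<partial>lborel)"
      "\<And>js x. js \<in> L \<Longrightarrow> \<bar>(\<integral>z. foldr partial js \<phi> (x - z) * \<kappa> m z \<partial>lborel) - foldr partial js \<phi> x * (\<integral>z. \<kappa> m z \<partial>lborel)\<bar>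
            \<le> e / 2 * (\<integral>z. \<kappa> m z \<partial>lborel)"
      by (auto simp: eventually_sequentially)
    define I where "I = (\<integral>z. \<kappa> m z \<partial>lborel)"
    have I: "0 < I" using m(1)[of "[]"] by (simp add: I_def L_def)
    define fine_enough where "fine_enough js d \<longleftrightarrow> (\<forall>p. p tagged_division_of (cbox (- b) b) \<longrightarrow> (\<lambda>y. ball y d) fine p \<longrightarrow>
      (\<forall>x. \<bar>(\<Sum>(y, K)\<in>p. measure lborel K * (\<phi> y * foldr partial js (\<kappa> m) (x - y)))
          - (\<integral>y. \<phi> y * foldr partial js (\<kappa> m) (x - y) \<partial>lborel)\<bar> \<le> e / 2 * I))" for js d
    have "\<exists>\<delta>>0. fine_enough js \<delta>" for js
    proof -
      obtain R' where R': "\<And>x. R' < norm x \<Longrightarrow> foldr partial js (\<kappa> m) x = 0"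
        using test_functions_partial[OF \<kappa>_test] unfolding test_functions_iff_bounded by blast
      have outside: "\<phi> y = 0" if "y \<notin> cbox (- b) b" for y
        using that b R1[of y] by (meson mem_cball_0 not_le subsetD)
      have pos: "0 < e / 2 * I" using e I by simp
      show ?thesis unfolding fine_enough_def
        by (rule convolution_Riemann_sum[OF smooth_continuous_on[OF sm, of UNIV "[]", simplified] R1 outside
              smooth_continuous_on[OF \<kappa>_smooth] R' pos])
    qed
    then obtain \<delta> where \<delta>: "\<And>js. 0 < \<delta> js" "\<And>js. fine_enough js (\<delta> js)"
      by metis
    define \<delta>0 where "\<delta>0 = Min (\<delta> ` L)"
    have "[] \<in> L" by (simp add: L_def)
    then have "0 < \<delta>0" unfolding \<delta>0_def using L \<delta>(1) by (subst Min_gr_iff) auto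
    then obtain p where p: "p tagged_division_of (cbox (- b) b)" "(\<lambda>y. ball y \<delta>0) fine p"
      using fine_division_exists[of "\<lambda>y. ball y \<delta>0"] gauge_ball by metis
    have fine: "(\<lambda>y. ball y (\<delta> js)) fine p" if "js \<in> L" for js
    proof -
      have "\<delta>0 \<le> \<delta> js" using that L by (simp add: \<delta>0_def)
      then show ?thesis using p(2) subset_ball unfolding fine_def by blast
    qed
    have fin: "finite p" using p(1) by blast
    \<comment> \<open>The Riemann weights, normalized by the total mass \<open>I\<close> of the
      kernel.\<close>
    define a where "a t = measure lborel (snd t) * \<phi> (fst t) / I" for t :: "(real^'d) \<times> (real^'d) set"
    define w where "w x = (\<Sum>t\<in>p. a t * tens (translated (G m) (fst t)) (\<lambda>_. 0) x)" for x
    have sm_t: "smooth (tens (translated (G m) y) (\<lambda>_. 0))" for y :: "real^'d"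
      by (intro smooth_tens small_seq_translate dG)
    have "w \<in> linear_span E"
      unfolding w_def[abs_def] by (intro linear_span_sum fin span G)
    moreover have "smooth w"
      unfolding w_def[abs_def] by (intro smooth_sum fin sm_t)
    moreover have "w x = 0" if "R < norm x" for x
      unfolding w_def
    proof (rule sum.neutral, rule ballI)
      fix t assume "t \<in> p"
      then have "fst t \<in> cbox (- b) b" using tag_in_interval[OF p(1), of "fst t" "snd t"] by simp
      then have "tens (translated (G m) (fst t)) (\<lambda>_. 0) x = 0"
        using that R0 by (intro tens_translated_zero_outside[of R0 "G m" _ "fst t" Y] Y) (auto simp: G(2) R_def)
      then show "a t * tens (translated (G m) (fst t)) (\<lambda>_. 0) x = 0" by simp
    qed
    moreover have "\<bar>foldr partial js w x - foldr partial js \<phi> x\<bar> \<le> e" if "length js \<le> n" for js x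
    proof -
      have js: "js \<in> L" using that by (simp add: L_def)
      define S where "S = (\<Sum>(y, K)\<in>p. measure lborel K * (\<phi> y * foldr partial js (\<kappa> m) (x - y)))"
      define C where "C = (\<integral>y. \<phi> y * foldr partial js (\<kappa> m) (x - y) \<partial>lborel)"
      have "foldr partial js w x = (\<Sum>t\<in>p. a t * foldr partial js (tens (translated (G m) (fst t)) (\<lambda>_. 0)) x)"
        unfolding w_def[abs_def] by (subst foldr_partial_sum[OF sm_t]) simp
      also have "\<dots> = (\<Sum>t\<in>p. a t * foldr partial js (\<kappa> m) (x - fst t))"
        by (simp add: foldr_partial_tens small_seq_translate dG D_\<kappa> tens_translated)
      also have "\<dots> = S / I"
        by (simp add: S_def a_def case_prod_unfold sum_divide_distrib mult.assoc)
      finally have w: "foldr partial js w x = S / I" .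
      have 1: "\<bar>S - C\<bar> \<le> e / 2 * I"
        unfolding S_def C_def using \<delta>(2)[of js] p(1) fine[OF js] unfolding fine_enough_def by blast
      \<comment> \<open>Derivatives of the product kernel depend only on how often each coordinate
        occurs. Reversing the word here makes the second reversal, on transfer to
        \<open>\<phi>\<close>, give back \<open>js\<close>.\<close>
      have "C = (\<integral>y. \<phi> y * foldr partial (rev js) (\<kappa> m) (x - y) \<partial>lborel)"
      proof -
        have "count_list (rev js) = count_list js" by (simp add: fun_eq_iff)
        then show ?thesis by (simp only: C_def D_\<kappa>)
      qed
      also have "\<dots> = (\<integral>y. foldr partial js \<phi> y * \<kappa> m (x - y) \<partial>lborel)"
        by (simp add: integral_convolution_foldr_partial[OF \<phi> \<kappa>_smooth])
      also have "\<dots> = (\<integral>z. foldr partial js \<phi> (x - z) * \<kappa> m z \<partial>lborel)"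
      proof -
        have "(\<lambda>z. foldr partial js \<phi> (x - z) * \<kappa> m z) \<in> borel_measurable borel"
          using borel_measurable_continuous_onI[OF smooth_continuous_on[OF sm, of UNIV js]]
            borel_measurable_continuous_onI[OF smooth_continuous_on[OF \<kappa>_smooth, of UNIV "[]" m]] by simp
        from integral_reflect[OF this, of x] show ?thesis by simp
      qed
      finally have 2: "\<bar>C - foldr partial js \<phi> x * I\<bar> \<le> e / 2 * I"
        using m(2)[OF js, of x] by (simp add: I_def)
      have "\<bar>S - foldr partial js \<phi> x * I\<bar> \<le> e * I" using 1 2 by linarith
      then have "\<bar>(S / I - foldr partial js \<phi> x) * I\<bar> \<le> e * I" using I by (simp add: left_diff_distrib)
      then show ?thesis using I by (simp add: w abs_mult)
    qed
    ultimately show ?thesis by blast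
  qed
  have "\<forall>n. \<exists>w. w \<in> linear_span E \<and> smooth w \<and> (\<forall>x. R < norm x \<longrightarrow> w x = 0) \<and>
      (\<forall>js x. length js \<le> n \<longrightarrow> \<bar>foldr partial js w x - foldr partial js \<phi> x\<bar> \<le> 1 / real (Suc n))"
    using step by (simp add: Bex_def)
  then obtain w where w: "\<And>n. w n \<in> linear_span E" "\<And>n. smooth (w n)" "\<And>n x. R < norm x \<Longrightarrow> w n x = 0"
    "\<And>n js x. length js \<le> n \<Longrightarrow> \<bar>foldr partial js (w n) x - foldr partial js \<phi> x\<bar> \<le> 1 / real (Suc n)"
    by metis
  have "\<forall>x. R < norm x \<longrightarrow> \<phi> x = 0 \<and> (\<forall>n. w n x = 0)" using R1 w(3) by (simp add: R_def)
  then have "test_converges w \<phi>" unfolding test_converges_def using sm w(2,4) by blast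
  with w(1) show ?thesis by blast
qed

theorem lemma2p5:
  fixes c :: "nat \<Rightarrow> real"
    and m :: "nat \<Rightarrow> ((nat \<Rightarrow> real^'d::finite) \<Rightarrow> real) \<Rightarrow> real"
    and k :: "nat \<Rightarrow> nat \<times> (real^'d \<Rightarrow> real)"
  assumes "\<And>n. 0 < c n"
    and "incseq c"
    and "\<not> quasi_analytic c"
    and "m \<in> F_space"
    and "\<And>n. k n \<in> weight_index"
    and "\<And>n. m n \<in> H_dual_tensor (k n) n"
  shows "D_topology closure_of (linear_span
    {f \<in> test_functions. \<forall>n.
      H_norm (k n) f \<le> c (fst (k n)) ^ CARD('d) *
        (SUP z \<in> cball 0 (real n). SUP x \<in> {x. \<forall>i. x $ i \<in> {-1..1}}. sqrt (snd (k n) (z + x)))})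
    = test_functions"
proof -
  define E where "E = {f \<in> test_functions. \<forall>n.
      H_norm (k n) f \<le> c (fst (k n)) ^ CARD('d) * weight_sup (snd (k n)) (real n)}"
  obtain F where F: "small_seq c F" "0 < F 0 0"
    using small_seq_exists[OF assms(1-3)] by blast
  have span: "(\<lambda>x. a * tens (translated G y) (\<lambda>_. 0) x) \<in> linear_span E" if G: "small_seq c G" for G y a
  proof -
    define f where "f = tens (translated G y) (\<lambda>_. 0)"
    have f: "f \<in> test_functions" unfolding f_def by (rule tens_translated_test_function[OF G])
    then have sm: "smooth f" by (simp add: test_functions_def)
    obtain L where L: "0 < L" "\<And>n. H_norm (k n) f \<le> L * (c (fst (k n)) ^ CARD('d) * weight_sup (snd (k n)) (real n))"
      by (rule tens_translated_H_norm_bound[OF assms(1,2,5) G, where y = y, folded f_def]) (rule that)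
    \<comment> \<open>Homogeneity of the norms allows one scaling to meet all the inequalities
      defining \<open>E\<close>; the span then recovers every multiple of \<open>f\<close>.\<close>
    have "(\<lambda>x. 1 / L * f x) \<in> E"
    proof -
      have "(\<lambda>x. 1 / L * f x) \<in> test_functions"
        using f smooth_scale[OF sm, of "1 / L"] unfolding test_functions_iff_bounded by auto
      moreover have "H_norm (k n) (\<lambda>x. 1 / L * f x) \<le> c (fst (k n)) ^ CARD('d) * weight_sup (snd (k n)) (real n)" for n
        using L(2)[of n] L(1) unfolding H_norm_scale[OF sm] by (simp add: divide_le_eq mult.commute)
      ultimately show ?thesis by (simp add: E_def)
    qed
    from linear_span_scale[OF this, of "a * L"] show ?thesis
      using L(1) by (simp add: f_def)
  qed
  have "D_topology closure_of (linear_span E) = test_functions"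
    by (rule D_topology_dense, rule test_function_approximation[OF assms(1,2) F _ span])
  then show ?thesis unfolding E_def weight_sup_def .
qed

end
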